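(* Let $f$ be a nonnegative operator monotone decreasing function on $(0,\infty)$, and let $\omega$ be a positive linear functional on $B(\mathcal{H})$. Then the functional $$A\in B(\mathcal{H})^{++}\mapsto\log\omega(f(A))\in[-\infty,\infty)$$ is convex.
   Context: $\mathcal{H}$ is an infinite-dimensional separable Hilbert space, and $B(\mathcal{H})^{++}$ is the set of positive (i.e. positive semidefinite) invertible bounded operators on $\mathcal{H}$. $f(A)$ is defined by continuous functional calculus. A continuous real function $f$ on $(0,\infty)$ is operator monotone decreasing if $A\ge B$ implies $f(A)\le f(B)$ for $A,B\in B(\mathcal{H})^{++}$. Convention: $\log 0=-\infty$, and convexity of $[-\infty,\infty)$-valued functions is understood in the usual extended sense. *)

theory Defs
  imports "HOL-Analysis.Analysis"
begin

section \<open>Complex Hilbert spaces\<close>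

text \<open>The real inner product of the parent class \<^class>\<open>real_inner\<close> is the real part of the
  complex one, so norm, topology and completeness are the library's. The complex inner product is
  linear in the second argument.\<close>

class chilbert_space = real_inner + banach +
  fixes scaleC :: "complex \<Rightarrow> 'a \<Rightarrow> 'a"  (infixr \<open>*\<^sub>C\<close> 75)
    and cinner :: "'a \<Rightarrow> 'a \<Rightarrow> complex"
  assumes scaleC_of_real: "of_real r *\<^sub>C x = r *\<^sub>R x"
    and scaleC_add_right: "c *\<^sub>C (x + y) = c *\<^sub>C x + c *\<^sub>C y"
    and scaleC_add_left: "(c + d) *\<^sub>C x = c *\<^sub>C x + d *\<^sub>C x"
    and scaleC_scaleC: "c *\<^sub>C d *\<^sub>C x = (c * d) *\<^sub>C x"
    and cinner_commute: "cinner x y = cnj (cinner y x)"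
    and cinner_add_right: "cinner x (y + z) = cinner x y + cinner x z"
    and cinner_scaleC_right: "cinner x (c *\<^sub>C y) = c * cinner x y"
    and Re_cinner: "Re (cinner x y) = inner x y"

lemma scaleC_one: "1 *\<^sub>C (x :: 'h::chilbert_space) = x"
  using scaleC_of_real[of 1 x] by simp

interpretation complex_vector:
  vector_space "scaleC :: complex \<Rightarrow> 'h \<Rightarrow> 'h::chilbert_space"
  by unfold_locales (simp_all add: scaleC_add_right scaleC_add_left scaleC_scaleC scaleC_one)

definition infinite_dimensional :: "'h::chilbert_space itself \<Rightarrow> bool" where
  "infinite_dimensional _ \<longleftrightarrow> (\<nexists>S::'h set. finite S \<and> complex_vector.span S = UNIV)"

lemma cinner_self: "cinner x x = of_real ((norm x)\<^sup>2)" for x :: "'h::chilbert_space"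
proof -
  have "Im (cinner x x) = 0"
    using arg_cong[OF cinner_commute[of x x], of Im] by simp
  then show ?thesis
    by (simp add: complex_eq_iff Re_cinner power2_norm_eq_inner)
qed

lemma norm_scaleC: "norm (c *\<^sub>C x) = cmod c * norm x" for x :: "'h::chilbert_space"
proof -
  have "cinner (c *\<^sub>C x) (c *\<^sub>C x) = c * cnj c * cinner x x"
    by (metis cinner_commute cinner_scaleC_right complex_cnj_mult mult.assoc)
  also have "\<dots> = of_real ((cmod c * norm x)\<^sup>2)"
    by (simp add: cinner_self complex_norm_square[symmetric] power_mult_distrib)
  finally have "(norm (c *\<^sub>C x))\<^sup>2 = (cmod c * norm x)\<^sup>2"
    unfolding cinner_self of_real_eq_iff .
  then show ?thesis
    by (simp add: power2_eq_iff_nonneg)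
qed

lemma bounded_linear_scaleC: "bounded_linear (\<lambda>x :: 'h::chilbert_space. c *\<^sub>C x)"
proof (rule bounded_linear_intro[where K = "cmod c"])
  fix r and x :: 'h
  show "c *\<^sub>C r *\<^sub>R x = r *\<^sub>R c *\<^sub>C x"
    by (simp add: scaleC_of_real[symmetric] scaleC_scaleC mult.commute)
qed (simp_all add: scaleC_add_right norm_scaleC mult.commute)

section \<open>Bounded operators\<close>

text \<open>The elements of \<^typ>\<open>'h \<Rightarrow>\<^sub>L 'h\<close> are the bounded \<^emph>\<open>real\<close>-linear operators;
  \<open>bounded_ops\<close>, the algebra $B(H)$, consists of the complex-linear ones.\<close>

definition bounded_ops :: "('h::chilbert_space \<Rightarrow>\<^sub>L 'h) set" where
  "bounded_ops = {A :: 'h \<Rightarrow>\<^sub>L 'h. \<forall>c x. A (c *\<^sub>C x) = c *\<^sub>C A x}"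

lift_definition scaleC_op :: "complex \<Rightarrow> ('h::chilbert_space \<Rightarrow>\<^sub>L 'h) \<Rightarrow> 'h \<Rightarrow>\<^sub>L 'h"
  is "\<lambda>c A x. c *\<^sub>C A x"
  by (rule bounded_linear_compose[OF bounded_linear_scaleC])

definition invertible_op :: "('h::chilbert_space \<Rightarrow>\<^sub>L 'h) \<Rightarrow> bool" where
  "invertible_op A \<longleftrightarrow> (\<exists>B\<in>bounded_ops. A o\<^sub>L B = id_blinfun \<and> B o\<^sub>L A = id_blinfun)"

definition positive_op :: "('h::chilbert_space \<Rightarrow>\<^sub>L 'h) \<Rightarrow> bool" where
  "positive_op A \<longleftrightarrow> A \<in> bounded_ops \<and> (\<forall>x. cinner x (A x) \<in> \<real>\<^sub>\<ge>\<^sub>0)"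

definition positive_invertible_ops :: "('h::chilbert_space \<Rightarrow>\<^sub>L 'h) set" where
  "positive_invertible_ops = {A. positive_op A \<and> invertible_op A}"

definition op_le :: "('h::chilbert_space \<Rightarrow>\<^sub>L 'h) \<Rightarrow> ('h \<Rightarrow>\<^sub>L 'h) \<Rightarrow> bool" where
  "op_le A B \<longleftrightarrow> positive_op (B - A)"

section \<open>Continuous functional calculus\<close>

definition spectrum_op :: "('h::chilbert_space \<Rightarrow>\<^sub>L 'h) \<Rightarrow> complex set" where
  "spectrum_op A = {z. \<not> invertible_op (A - scaleC_op z id_blinfun)}"

primrec power_op :: "('h::real_normed_vector \<Rightarrow>\<^sub>L 'h) \<Rightarrow> nat \<Rightarrow> 'h \<Rightarrow>\<^sub>L 'h" where
  "power_op A 0 = id_blinfun"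
| "power_op A (Suc n) = A o\<^sub>L power_op A n"

definition poly_op :: "real poly \<Rightarrow> ('h::real_normed_vector \<Rightarrow>\<^sub>L 'h) \<Rightarrow> 'h \<Rightarrow>\<^sub>L 'h" where
  "poly_op p A = (\<Sum>i\<le>degree p. coeff p i *\<^sub>R power_op A i)"

text \<open>For self-adjoint \<open>A\<close> (whose spectrum is a compact subset of the real line) and real \<open>f\<close>
  continuous on the spectrum, \<open>f(A)\<close> is the operator-norm limit of \<open>p\<^sub>n(A)\<close> for every sequence of
  real polynomials \<open>p\<^sub>n\<close> converging to \<open>f\<close> uniformly on the spectrum. Outside that situation the
  definition is not meaningful.\<close>

definition cfc :: "(real \<Rightarrow> real) \<Rightarrow> ('h::chilbert_space \<Rightarrow>\<^sub>L 'h) \<Rightarrow> 'h \<Rightarrow>\<^sub>L 'h" where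
  "cfc f A = (THE B. \<forall>p :: nat \<Rightarrow> real poly.
     uniform_limit {t. complex_of_real t \<in> spectrum_op A} (\<lambda>n. poly (p n)) f sequentially
       \<longrightarrow> (\<lambda>n. poly_op (p n) A) \<longlonglongrightarrow> B)"

definition operator_monotone_decreasing ::
    "'h::chilbert_space itself \<Rightarrow> (real \<Rightarrow> real) \<Rightarrow> bool" where
  "operator_monotone_decreasing _ f \<longleftrightarrow> continuous_on {0<..} f \<and>
     (\<forall>A\<in>positive_invertible_ops. \<forall>B\<in>(positive_invertible_ops :: ('h \<Rightarrow>\<^sub>L 'h) set).
        op_le B A \<longrightarrow> op_le (cfc f A) (cfc f B))"

section \<open>Functionals and convexity\<close>

text \<open>Only the values on \<^const>\<open>bounded_ops\<close> are constrained.\<close>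

definition positive_linear_functional :: "(('h::chilbert_space \<Rightarrow>\<^sub>L 'h) \<Rightarrow> complex) \<Rightarrow> bool" where
  "positive_linear_functional \<omega> \<longleftrightarrow>
     (\<forall>A\<in>bounded_ops. \<forall>B\<in>bounded_ops. \<omega> (A + B) = \<omega> A + \<omega> B) \<and>
     (\<forall>c. \<forall>A\<in>bounded_ops. \<omega> (scaleC_op c A) = c * \<omega> A) \<and>
     (\<forall>A. positive_op A \<longrightarrow> \<omega> A \<in> \<real>\<^sub>\<ge>\<^sub>0)"

text \<open>The logarithm on $[0,\infty)$ with $\log 0 = -\infty$; negative arguments are irrelevant.\<close>

definition eln :: "real \<Rightarrow> ereal" where
  "eln t = (if t > 0 then ereal (ln t) else - \<infinity>)"

text \<open>Convexity for functions with values in $[-\infty,\infty)$. In \<^typ>\<open>ereal\<close>,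
  \<open>0 * (-\<infinity>) = 0\<close>, so the cases \<open>u = 0\<close> and \<open>v = 0\<close> are trivial.\<close>

definition ereal_convex_on :: "'a::real_vector set \<Rightarrow> ('a \<Rightarrow> ereal) \<Rightarrow> bool" where
  "ereal_convex_on S g \<longleftrightarrow> convex S \<and> (\<forall>x\<in>S. g x < \<infinity>) \<and>
     (\<forall>x\<in>S. \<forall>y\<in>S. \<forall>u\<ge>0. \<forall>v\<ge>0. u + v = 1 \<longrightarrow>
        g (u *\<^sub>R x + v *\<^sub>R y) \<le> ereal u * g x + ereal v * g y)"

end

theory Submission
  imports Defs "HOL-Computational_Algebra.Fundamental_Theorem_Algebra"
begin

text \<open>
  Let \<open>M = u A + v B\<close> be a convex combination with positive weights. The operator inequality behind
  the result is
  \[ f(M) \le \frac{p^2}{u} f(A) + \frac{q^2}{v} f(B) \quad\mbox{whenever } p + q = 1 \]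
  (\<open>cfc_weighted_mean_le\<close>). A positive functional \<open>\<omega>\<close> carries it over to the numbers \<open>\<omega>(f(A))\<close> and
  \<open>\<omega>(f(B))\<close>, and minimizing over \<open>p\<close> bounds \<open>\<omega>(f(M))\<close> by their weighted harmonic mean. That is at
  most their weighted geometric mean, which is the asserted logarithmic convexity
  (\<open>eln_le_weighted_sum\<close>).

  The operator inequality comes from a dilation. Since \<open>H\<close> is infinite-dimensional, \<open>H \<oplus> H\<close> is
  isomorphic to \<open>H\<close> (\<open>splitting_exists\<close>), so monotonicity of \<open>f\<close> may be applied to two-by-two block
  matrices of operators. After a rotation, \<open>A \<oplus> B\<close> has \<open>M\<close> as a corner and is
  dominated by \<open>(M + d) \<oplus> r\<close> for small \<open>d\<close> and large \<open>r\<close>. Monotonicity reverses the inequality, and as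
  \<open>f(r) \<ge> 0\<close> the second corner can be discarded (\<open>cfc_rotated_sum_le\<close>).

  The functional calculus has to be shown to be well defined, positive, continuous in the
  operator and compatible with direct sums. All this follows from one fact about polynomials: if
  \<open>p \<ge> 0\<close> on the spectrum of a self-adjoint \<open>A\<close>, then \<open>p(A) \<ge> 0\<close> (\<open>poly_op_nonneg\<close>). It rests on the
  factorization of real polynomials and on the theorem of Lax and Milgram.
\<close>

section \<open>Self-adjoint operators and their quadratic forms\<close>

lemma Im_cinner: "Im (cinner x y) = - inner x (\<i> *\<^sub>C y)" for x y :: "'h::chilbert_space"
  by (simp add: Re_cinner[symmetric] cinner_scaleC_right)

lemma scaleC_ii_ii: "\<i> *\<^sub>C \<i> *\<^sub>C x = - x" for x :: "'h::chilbert_space"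
  using scaleC_of_real[of "-1" x] by (simp add: scaleC_scaleC)

lemma inner_ii_ii: "inner (\<i> *\<^sub>C x) (\<i> *\<^sub>C y) = inner x y" for x y :: "'h::chilbert_space"
proof -
  have "cinner (\<i> *\<^sub>C x) (\<i> *\<^sub>C y) = \<i> * cnj (\<i> * cinner y x)"
    by (metis cinner_commute cinner_scaleC_right)
  also have "\<dots> = cinner x y"
    by (simp add: cinner_commute[of x y])
  finally show ?thesis
    by (metis Re_cinner)
qed

text \<open>For complex-linear operators, symmetry with respect to the real inner product is equivalent to
  symmetry with respect to the complex one: apply it to \<open>x\<close> and \<open>\<i> y\<close>. So the inequalities below
  only ever involve real quadratic forms.\<close>

definition symmetric_op :: "('h::chilbert_space \<Rightarrow>\<^sub>L 'h) \<Rightarrow> bool" where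
  "symmetric_op A \<longleftrightarrow> A \<in> bounded_ops \<and> (\<forall>x y. inner (A x) y = inner x (A y))"

lemma symmetric_op_bounded_ops: "symmetric_op A \<Longrightarrow> A \<in> bounded_ops"
  by (simp add: symmetric_op_def)

lemma symmetric_op_inner: "symmetric_op A \<Longrightarrow> inner (A x) y = inner x (A y)"
  by (simp add: symmetric_op_def)

lemma scaleC_scaleR: "c *\<^sub>C (r *\<^sub>R x) = r *\<^sub>R (c *\<^sub>C x)" for x :: "'h::chilbert_space"
  by (simp add: scaleC_of_real[symmetric] scaleC_scaleC mult.commute)

lemma scaleC_diff_right: "c *\<^sub>C (x - y) = c *\<^sub>C x - c *\<^sub>C y" for x :: "'h::chilbert_space"
  by (rule complex_vector.scale_right_diff_distrib)

lemma bounded_ops_add: "A \<in> bounded_ops \<Longrightarrow> B \<in> bounded_ops \<Longrightarrow> A + B \<in> bounded_ops"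
  by (simp add: bounded_ops_def blinfun.add_left scaleC_add_right)

lemma bounded_ops_diff: "A \<in> bounded_ops \<Longrightarrow> B \<in> bounded_ops \<Longrightarrow> A - B \<in> bounded_ops"
  by (simp add: bounded_ops_def blinfun.diff_left scaleC_diff_right)

lemma bounded_ops_scaleR: "A \<in> bounded_ops \<Longrightarrow> r *\<^sub>R A \<in> bounded_ops"
  by (simp add: bounded_ops_def blinfun.scaleR_left scaleC_scaleR)

lemma bounded_ops_id: "id_blinfun \<in> bounded_ops"
  by (simp add: bounded_ops_def)

lemma bounded_ops_compose: "A \<in> bounded_ops \<Longrightarrow> B \<in> bounded_ops \<Longrightarrow> A o\<^sub>L B \<in> bounded_ops"
  by (simp add: bounded_ops_def)

lemma symmetric_op_add: "symmetric_op A \<Longrightarrow> symmetric_op B \<Longrightarrow> symmetric_op (A + B)"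
  by (simp add: symmetric_op_def bounded_ops_add blinfun.add_left inner_add)

lemma symmetric_op_diff: "symmetric_op A \<Longrightarrow> symmetric_op B \<Longrightarrow> symmetric_op (A - B)"
  by (simp add: symmetric_op_def bounded_ops_diff blinfun.diff_left inner_diff)

lemma symmetric_op_scaleR: "symmetric_op A \<Longrightarrow> symmetric_op (r *\<^sub>R A)"
  by (simp add: symmetric_op_def bounded_ops_scaleR blinfun.scaleR_left)

lemma symmetric_op_id: "symmetric_op id_blinfun"
  by (simp add: symmetric_op_def bounded_ops_id)

text \<open>Polarization over the complex scalars: if all values of the sesquilinear form on the diagonal
  are real, then substituting \<open>\<i> y\<close> for \<open>y\<close> in the polarized identity gives symmetry.\<close>

lemma positive_op_iff:
  "positive_op A \<longleftrightarrow> symmetric_op A \<and> (\<forall>x. 0 \<le> inner x (A x))"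
proof
  assume pos: "positive_op A"
  then have bA: "A (c *\<^sub>C x) = c *\<^sub>C A x" for c x
    by (simp add: positive_op_def bounded_ops_def)
  have diag: "cinner x (A x) \<in> \<real>\<^sub>\<ge>\<^sub>0" for x
    using pos by (simp add: positive_op_def)
  then have im0: "inner x (\<i> *\<^sub>C A x) = 0" for x
    using Im_cinner[of x "A x"] by (simp add: complex_nonneg_Reals_iff)
  have pol: "inner x (\<i> *\<^sub>C A y) + inner y (\<i> *\<^sub>C A x) = 0" for x y
    using im0[of "x + y"] im0[of x] im0[of y]
    by (simp add: blinfun.add_right scaleC_add_right inner_add)
  have "inner (A x) y = inner x (A y)" for x y
    using pol[of x "\<i> *\<^sub>C y"]
    by (simp add: bA scaleC_ii_ii inner_ii_ii inner_commute)
  moreover have "0 \<le> inner x (A x)" for x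
    using diag[of x] Re_cinner[of x "A x"] by (simp add: complex_nonneg_Reals_iff)
  ultimately show "symmetric_op A \<and> (\<forall>x. 0 \<le> inner x (A x))"
    using pos by (simp add: symmetric_op_def positive_op_def)
next
  assume A: "symmetric_op A \<and> (\<forall>x. 0 \<le> inner x (A x))"
  then have bA: "A (c *\<^sub>C x) = c *\<^sub>C A x" for c x
    by (simp add: symmetric_op_def bounded_ops_def)
  have "Im (cinner x (A x)) = 0" for x
  proof -
    have "inner x (\<i> *\<^sub>C A x) = inner (A x) (\<i> *\<^sub>C x)"
      using A by (metis bA symmetric_op_inner)
    also have "\<dots> = inner (\<i> *\<^sub>C A x) (\<i> *\<^sub>C \<i> *\<^sub>C x)"
      by (rule inner_ii_ii[symmetric])
    also have "\<dots> = - inner x (\<i> *\<^sub>C A x)"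
      by (simp add: scaleC_ii_ii inner_commute)
    finally show ?thesis
      by (simp add: Im_cinner)
  qed
  then show "positive_op A"
    using A by (simp add: positive_op_def symmetric_op_def complex_nonneg_Reals_iff Re_cinner)
qed

definition form_between :: "real \<Rightarrow> real \<Rightarrow> ('h::chilbert_space \<Rightarrow>\<^sub>L 'h) \<Rightarrow> bool" where
  "form_between m L A \<longleftrightarrow> symmetric_op A \<and>
     (\<forall>x. m * (norm x)\<^sup>2 \<le> inner x (A x) \<and> inner x (A x) \<le> L * (norm x)\<^sup>2)"

lemma form_between_symmetric: "form_between m L A \<Longrightarrow> symmetric_op A"
  by (simp add: form_between_def)

lemma form_between_mono:
  fixes A :: "'h::chilbert_space \<Rightarrow>\<^sub>L 'h"
  assumes "form_between m L A" "m' \<le> m" "L \<le> L'"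
  shows "form_between m' L' A"
  unfolding form_between_def
proof (intro conjI allI)
  show "symmetric_op A" using assms form_between_symmetric by blast
  fix x :: 'h
  have "m' * (norm x)\<^sup>2 \<le> m * (norm x)\<^sup>2" "L * (norm x)\<^sup>2 \<le> L' * (norm x)\<^sup>2"
    using assms by (auto intro: mult_right_mono)
  then show "m' * (norm x)\<^sup>2 \<le> inner x (A x)" "inner x (A x) \<le> L' * (norm x)\<^sup>2"
    using assms(1) unfolding form_between_def by (meson order_trans)+
qed

lemma abs_inner_blinfun_le: "\<bar>inner x (A y)\<bar> \<le> norm A * norm x * norm y"
  for A :: "'h::real_inner \<Rightarrow>\<^sub>L 'h"
proof -
  have "\<bar>inner x (A y)\<bar> \<le> norm x * norm (A y)"
    by (rule Cauchy_Schwarz_ineq2)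
  also have "\<dots> \<le> norm x * (norm A * norm y)"
    by (intro mult_left_mono norm_blinfun norm_ge_zero)
  finally show ?thesis by (simp add: mult_ac)
qed

lemma inner_blinfun_self_le: "inner x (A x) \<le> norm A * (norm x)\<^sup>2"
  for A :: "'h::real_inner \<Rightarrow>\<^sub>L 'h"
  using abs_inner_blinfun_le[of x A x] by (simp add: power2_eq_square mult.assoc)

section \<open>Invertibility\<close>

lemma invertible_opI:
  assumes "A \<in> bounded_ops" "\<And>y. \<exists>x. A x = y" "0 < m" "\<And>x. m * norm x \<le> norm (A x)"
  shows "invertible_op A"
proof -
  have inj: "x = y" if "A x = A y" for x y
  proof -
    have "m * norm (x - y) \<le> 0"
      using assms(4)[of "x - y"] that by (simp add: blinfun.diff_right)
    then show ?thesis using \<open>0 < m\<close> by (simp add: mult_le_0_iff)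
  qed
  define g where "g y = (SOME x. A x = y)" for y
  have Ag: "A (g y) = y" for y
    unfolding g_def using assms(2) by (rule someI_ex)
  have gA: "g (A x) = x" for x
    using inj Ag by blast
  have "bounded_linear g"
  proof (rule bounded_linear_intro[where K = "1 / m"])
    show "g (x + y) = g x + g y" for x y
      by (rule inj) (simp add: blinfun.add_right Ag)
    show "g (r *\<^sub>R x) = r *\<^sub>R g x" for r x
      by (rule inj) (simp add: blinfun.scaleR_right Ag)
    show "norm (g x) \<le> norm x * (1 / m)" for x
      using assms(4)[of "g x"] \<open>0 < m\<close> by (simp add: Ag field_simps)
  qed
  then have B: "blinfun_apply (Blinfun g) = g"
    by (rule bounded_linear_Blinfun_apply)
  have "g (c *\<^sub>C x) = c *\<^sub>C g x" for c x
    by (rule inj) (use assms(1) in \<open>simp add: bounded_ops_def Ag\<close>)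
  then have "Blinfun g \<in> bounded_ops"
    by (simp add: bounded_ops_def B)
  moreover have "A o\<^sub>L Blinfun g = id_blinfun" "Blinfun g o\<^sub>L A = id_blinfun"
    by (auto intro!: blinfun_eqI simp: B Ag gA)
  ultimately show ?thesis
    unfolding invertible_op_def by blast
qed

text \<open>The theorem of Lax and Milgram: for small \<open>\<tau>\<close> the map \<open>x \<mapsto> x - \<tau> (A x - y)\<close> is a contraction,
  and its fixed point solves \<open>A x = y\<close>.\<close>

lemma invertible_op_coercive:
  assumes "A \<in> bounded_ops" "0 < m" and low: "\<And>x. m * (norm x)\<^sup>2 \<le> inner x (A x)"
  shows "invertible_op A"
proof (rule invertible_opI)
  define K where "K = norm A + m"
  define \<tau> where "\<tau> = m / K\<^sup>2"
  have K: "0 < K" "m \<le> K" using \<open>0 < m\<close> by (simp_all add: K_def add_nonneg_pos)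
  have "\<tau> > 0" using K \<open>0 < m\<close> by (simp add: \<tau>_def)
  define q where "q = 1 - m\<^sup>2 / K\<^sup>2"
  have q: "0 \<le> q" "q < 1"
    using K \<open>0 < m\<close> by (simp_all add: q_def divide_simps power_mono)
  have contr: "norm (x - \<tau> *\<^sub>R A x) \<le> sqrt q * norm x" for x
  proof -
    have "norm (A x) \<le> K * norm x"
      using norm_blinfun[of A x] \<open>0 < m\<close> by (simp add: K_def distrib_right add_increasing2)
    then have nA: "(norm (A x))\<^sup>2 \<le> K\<^sup>2 * (norm x)\<^sup>2"
      by (metis norm_ge_zero power_mono power_mult_distrib)
    have "(norm (x - \<tau> *\<^sub>R A x))\<^sup>2 = (norm x)\<^sup>2 - 2 * \<tau> * inner x (A x) + \<tau>\<^sup>2 * (norm (A x))\<^sup>2"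
      by (simp add: power2_norm_eq_inner inner_diff inner_commute power2_eq_square[of \<tau>])
    also have "\<dots> \<le> (norm x)\<^sup>2 - 2 * \<tau> * (m * (norm x)\<^sup>2) + \<tau>\<^sup>2 * (K\<^sup>2 * (norm x)\<^sup>2)"
      using \<open>\<tau> > 0\<close> low[of x] nA by (intro add_mono diff_mono mult_left_mono) auto
    also have "\<dots> = q * (norm x)\<^sup>2"
      using K by (simp add: q_def \<tau>_def power2_eq_square field_simps)
    finally have "(norm (x - \<tau> *\<^sub>R A x))\<^sup>2 \<le> (sqrt q * norm x)\<^sup>2"
      using q by (simp add: power_mult_distrib)
    then show ?thesis
      by (rule power2_le_imp_le) (use q in simp)
  qed
  show "\<exists>x. A x = y" for y
  proof -
    have "\<exists>!x. x - \<tau> *\<^sub>R (A x - y) = x"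
    proof (rule banach_fix_type)
      show "0 \<le> sqrt q" "sqrt q < 1" using q by simp_all
      show "\<forall>u v. dist (u - \<tau> *\<^sub>R (A u - y)) (v - \<tau> *\<^sub>R (A v - y)) \<le> sqrt q * dist u v"
      proof (intro allI)
        fix u v
        have "u - \<tau> *\<^sub>R (A u - y) - (v - \<tau> *\<^sub>R (A v - y)) = (u - v) - \<tau> *\<^sub>R A (u - v)"
          by (simp add: blinfun.diff_right algebra_simps)
        then show "dist (u - \<tau> *\<^sub>R (A u - y)) (v - \<tau> *\<^sub>R (A v - y)) \<le> sqrt q * dist u v"
          unfolding dist_norm using contr[of "u - v"] by (simp only:)
      qed
    qed
    then show ?thesis using \<open>\<tau> > 0\<close> by auto
  qed
  show "m * norm x \<le> norm (A x)" for x
  proof -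
    have "norm x * (m * norm x) \<le> norm x * norm (A x)"
      using low[of x] norm_cauchy_schwarz[of x "A x"] by (simp add: power2_eq_square mult_ac)
    then show ?thesis
      by (cases "x = 0") auto
  qed
qed fact+

text \<open>Cauchy--Schwarz for the form \<open>\<langle>x, A y\<rangle>\<close>, applied to \<open>x\<close> and \<open>A x\<close>. It is obtained from
  positivity at \<open>x - \<tau> A x\<close> with \<open>\<tau> = 1 / \<parallel>A\<parallel>\<close>.\<close>

lemma norm_apply_le_form:
  assumes "symmetric_op A" "\<And>x. 0 \<le> inner x (A x)"
  shows "(norm (A x))\<^sup>2 \<le> norm A * inner x (A x)"
proof (cases "A = 0")
  case False
  define \<tau> where "\<tau> = 1 / norm A"
  have "\<tau> > 0" using False by (simp add: \<tau>_def)
  have "0 \<le> inner (x - \<tau> *\<^sub>R A x) (A (x - \<tau> *\<^sub>R A x))"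
    by (rule assms(2))
  also have "\<dots> = inner x (A x) - 2 * \<tau> * (norm (A x))\<^sup>2 + \<tau>\<^sup>2 * inner (A x) (A (A x))"
    using symmetric_op_inner[OF assms(1), of x "A x"]
    by (simp add: blinfun.diff_right blinfun.scaleR_right inner_diff power2_norm_eq_inner
        power2_eq_square[of \<tau>] algebra_simps)
  also have "\<dots> \<le> inner x (A x) - 2 * \<tau> * (norm (A x))\<^sup>2 + \<tau>\<^sup>2 * (norm A * (norm (A x))\<^sup>2)"
    by (intro add_left_mono mult_left_mono inner_blinfun_self_le) auto
  also have "\<dots> = inner x (A x) - \<tau> * (norm (A x))\<^sup>2"
    using False by (simp add: \<tau>_def power2_eq_square)
  finally show ?thesis
    using False by (simp add: \<tau>_def field_simps)
qed simp

text \<open>An inverse bounds \<open>\<parallel>x\<parallel>\<close> by a multiple of \<open>\<parallel>A x\<parallel>\<close>; by the preceding inequality this turns into a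
  bound for the form of \<open>A\<close> itself.\<close>

lemma positive_invertible_lower_bound:
  fixes A :: "'h::chilbert_space \<Rightarrow>\<^sub>L 'h"
  assumes "symmetric_op A" "\<And>x. 0 \<le> inner x (A x)" "invertible_op A"
  obtains m where "0 < m" "\<And>x. m * (norm x)\<^sup>2 \<le> inner x (A x)"
proof -
  obtain B where B: "B o\<^sub>L A = id_blinfun"
    using assms(3) by (auto simp: invertible_op_def)
  define k where "k = (norm B)\<^sup>2 * norm A + 1"
  have "k > 0" by (simp add: k_def add_nonneg_pos)
  have "(norm x)\<^sup>2 \<le> k * inner x (A x)" for x :: 'h
  proof -
    have "x = B (A x)" using B by (metis blinfun_apply_blinfun_compose blinfun_apply_id_blinfun id_apply)
    then have "norm x \<le> norm B * norm (A x)" by (metis norm_blinfun)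
    then have "(norm x)\<^sup>2 \<le> (norm B)\<^sup>2 * (norm (A x))\<^sup>2"
      by (metis norm_ge_zero power_mono power_mult_distrib)
    also have "\<dots> \<le> (norm B)\<^sup>2 * (norm A * inner x (A x))"
      by (intro mult_left_mono norm_apply_le_form assms) auto
    also have "\<dots> \<le> k * inner x (A x)"
      using assms(2)[of x] by (simp add: k_def distrib_right mult.assoc)
    finally show ?thesis .
  qed
  then show thesis
    using that[of "1 / k"] \<open>k > 0\<close> by (simp add: field_simps)
qed

lemma positive_invertible_ops_iff:
  "A \<in> positive_invertible_ops \<longleftrightarrow> (\<exists>m L. 0 < m \<and> form_between m L A)"
proof
  assume "A \<in> positive_invertible_ops"
  then have A: "symmetric_op A" "\<And>x. 0 \<le> inner x (A x)" "invertible_op A"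
    by (auto simp: positive_invertible_ops_def positive_op_iff)
  from A obtain m where "0 < m" "\<And>x. m * (norm x)\<^sup>2 \<le> inner x (A x)"
    by (rule positive_invertible_lower_bound) auto
  then have "form_between m (norm A) A"
    using A by (simp add: form_between_def inner_blinfun_self_le)
  with \<open>0 < m\<close> show "\<exists>m L. 0 < m \<and> form_between m L A"
    by blast
next
  assume "\<exists>m L. 0 < m \<and> form_between m L A"
  then obtain m L where m: "0 < m" "form_between m L A" by blast
  then have "symmetric_op A" and low: "m * (norm x)\<^sup>2 \<le> inner x (A x)" for x
    by (auto simp: form_between_def)
  moreover have "0 \<le> inner x (A x)" for x
    using low[of x] m(1) by (meson mult_nonneg_nonneg less_imp_le order_trans zero_le_power2)
  moreover have "invertible_op A"
    using invertible_op_coercive[OF symmetric_op_bounded_ops m(1) low] calculation(1) by blast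
  ultimately show "A \<in> positive_invertible_ops"
    by (simp add: positive_invertible_ops_def positive_op_iff)
qed

lemma invertible_op_compose:
  assumes "invertible_op A" "invertible_op B"
  shows "invertible_op (A o\<^sub>L B)"
proof -
  obtain A' B' where
    A': "A' \<in> bounded_ops" "A o\<^sub>L A' = id_blinfun" "A' o\<^sub>L A = id_blinfun" and
    B': "B' \<in> bounded_ops" "B o\<^sub>L B' = id_blinfun" "B' o\<^sub>L B = id_blinfun"
    using assms by (auto simp: invertible_op_def)
  have "A (A' x) = x" "A' (A x) = x" "B (B' x) = x" "B' (B x) = x" for x
    using A' B' by (metis blinfun_apply_blinfun_compose blinfun_apply_id_blinfun id_apply)+
  then have "(A o\<^sub>L B) o\<^sub>L (B' o\<^sub>L A') = id_blinfun" "(B' o\<^sub>L A') o\<^sub>L (A o\<^sub>L B) = id_blinfun"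
    by (auto intro!: blinfun_eqI)
  then show ?thesis
    using bounded_ops_compose[OF B'(1) A'(1)] by (auto simp: invertible_op_def)
qed

section \<open>Polynomials of an operator\<close>

lemma poly_op_altdef:
  assumes "degree p \<le> n"
  shows "poly_op p A = (\<Sum>i\<le>n. coeff p i *\<^sub>R power_op A i)"
  unfolding poly_op_def
  by (rule sum.mono_neutral_left) (use assms in \<open>auto simp: coeff_eq_0\<close>)

lemma poly_op_pCons: "poly_op (pCons a p) A = a *\<^sub>R id_blinfun + (A o\<^sub>L poly_op p A)"
proof -
  have "poly_op (pCons a p) A = (\<Sum>i\<le>Suc (degree p). coeff (pCons a p) i *\<^sub>R power_op A i)"
    by (rule poly_op_altdef) (rule degree_pCons_le)
  also have "\<dots> = a *\<^sub>R id_blinfun + (\<Sum>i\<le>degree p. coeff p i *\<^sub>R (A o\<^sub>L power_op A i))"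
    by (subst sum.atMost_Suc_shift) simp
  also have "(\<Sum>i\<le>degree p. coeff p i *\<^sub>R (A o\<^sub>L power_op A i)) = A o\<^sub>L poly_op p A"
    by (rule blinfun_eqI)
      (simp add: poly_op_def blinfun.sum_left blinfun.sum_right blinfun.scaleR_left blinfun.scaleR_right)
  finally show ?thesis .
qed

lemma poly_op_0: "poly_op 0 A = 0"
  by (simp add: poly_op_def)

lemma poly_op_add: "poly_op (p + q) A = poly_op p A + poly_op q A"
proof -
  define n where "n = max (degree p) (degree q)"
  have "poly_op (p + q) A = (\<Sum>i\<le>n. coeff (p + q) i *\<^sub>R power_op A i)"
    by (rule poly_op_altdef) (simp add: n_def degree_add_le_max)
  then show ?thesis
    using poly_op_altdef[of p n A] poly_op_altdef[of q n A]
    by (simp add: n_def scaleR_add_left sum.distrib)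
qed

lemma poly_op_smult: "poly_op (smult c p) A = c *\<^sub>R poly_op p A"
  using poly_op_altdef[OF degree_smult_le, of c p A] by (simp add: poly_op_def scaleR_sum_right)

lemma poly_op_diff: "poly_op (p - q) A = poly_op p A - poly_op q A"
  using poly_op_add[of p "- q" A] poly_op_smult[of "-1" q A] by simp

lemma poly_op_const: "poly_op [:c:] A = c *\<^sub>R id_blinfun"
  by (simp add: poly_op_def)

lemma poly_op_mult: "poly_op (p * q) A = poly_op p A o\<^sub>L poly_op q A"
proof (induction p)
  case (pCons a p)
  have "poly_op (pCons a p * q) A = a *\<^sub>R poly_op q A + (A o\<^sub>L (poly_op p A o\<^sub>L poly_op q A))"
    by (simp add: poly_op_add poly_op_smult poly_op_pCons pCons.IH)
  also have "\<dots> = poly_op (pCons a p) A o\<^sub>L poly_op q A"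
    by (rule blinfun_eqI) (simp add: poly_op_pCons blinfun.add_left blinfun.scaleR_left)
  finally show ?case .
qed (simp add: poly_op_0)

lemma poly_op_commute: "poly_op p A (A x) = A (poly_op p A x)"
proof -
  have A: "poly_op [:0, 1:] A = A"
    by (rule blinfun_eqI)
      (simp add: poly_op_pCons poly_op_0 blinfun.add_left blinfun.scaleR_left blinfun.add_right
        blinfun.scaleR_right)
  have "poly_op (p * [:0, 1:]) A = poly_op ([:0, 1:] * p) A"
    by (simp only: mult.commute)
  then have "poly_op p A o\<^sub>L A = A o\<^sub>L poly_op p A"
    by (simp only: poly_op_mult A)
  then show ?thesis
    by (metis blinfun_apply_blinfun_compose)
qed

lemma poly_op_bounded_ops: "A \<in> bounded_ops \<Longrightarrow> poly_op p A \<in> bounded_ops"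
proof (induction p)
  case 0
  then show ?case by (simp add: poly_op_0 bounded_ops_def complex_vector.scale_zero_right)
next
  case (pCons a p)
  then show ?case
    by (simp add: poly_op_pCons bounded_ops_add bounded_ops_scaleR bounded_ops_id bounded_ops_compose)
qed

lemma poly_op_symmetric:
  assumes "symmetric_op A"
  shows "symmetric_op (poly_op p A)"
proof -
  have "inner (poly_op p A x) y = inner x (poly_op p A y)" for x y
  proof (induction p arbitrary: x y)
    case (pCons a p)
    have "inner (A (poly_op p A x)) y = inner x (A (poly_op p A y))"
      using assms by (simp add: symmetric_op_inner pCons.IH poly_op_commute)
    then show ?case
      by (simp add: poly_op_pCons blinfun.add_left blinfun.scaleR_left inner_add pCons.IH)
  qed (simp add: poly_op_0)
  then show ?thesis
    using assms poly_op_bounded_ops by (auto simp: symmetric_op_def)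
qed

lemma tendsto_poly_op:
  assumes "(A \<longlongrightarrow> B) F"
  shows "((\<lambda>i. poly_op p (A i)) \<longlongrightarrow> poly_op p B) F"
proof (induction p)
  case (pCons a p)
  then show ?case
    unfolding poly_op_pCons
    by (intro tendsto_add tendsto_const bounded_bilinear.tendsto[OF bounded_bilinear_blinfun_compose]
        assms)
qed (simp add: poly_op_0)

section \<open>Spectral bounds for polynomials\<close>

abbreviation real_spectrum :: "('h::chilbert_space \<Rightarrow>\<^sub>L 'h) \<Rightarrow> real set" where
  "real_spectrum A \<equiv> {t. complex_of_real t \<in> spectrum_op A}"

lemma scaleC_op_of_real: "scaleC_op (complex_of_real t) A = t *\<^sub>R A"
  by (rule blinfun_eqI) (simp add: scaleC_op.rep_eq scaleC_of_real blinfun.scaleR_left)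

lemma not_in_real_spectrum_iff:
  "t \<notin> real_spectrum A \<longleftrightarrow> invertible_op (A - t *\<^sub>R id_blinfun)"
  by (simp add: spectrum_op_def scaleC_op_of_real)

lemma poly_op_linear_factor: "poly_op [:- t, 1:] A = A - t *\<^sub>R id_blinfun"
  by (rule blinfun_eqI)
    (simp add: poly_op_pCons poly_op_0 blinfun.add_left blinfun.scaleR_left blinfun.diff_left
      blinfun.add_right blinfun.scaleR_right)

lemma invertible_op_scaleR_id:
  assumes "c \<noteq> 0"
  shows "invertible_op (c *\<^sub>R id_blinfun :: 'h::chilbert_space \<Rightarrow>\<^sub>L 'h)"
proof -
  have "(1 / c) *\<^sub>R id_blinfun \<in> (bounded_ops :: ('h \<Rightarrow>\<^sub>L 'h) set)"
    by (rule bounded_ops_scaleR[OF bounded_ops_id])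
  moreover have "c *\<^sub>R id_blinfun o\<^sub>L (1 / c) *\<^sub>R id_blinfun = (id_blinfun :: 'h \<Rightarrow>\<^sub>L 'h)"
    "(1 / c) *\<^sub>R id_blinfun o\<^sub>L c *\<^sub>R id_blinfun = (id_blinfun :: 'h \<Rightarrow>\<^sub>L 'h)"
    using assms by (auto intro!: blinfun_eqI simp: blinfun.scaleR_left)
  ultimately show ?thesis
    unfolding invertible_op_def by blast
qed

text \<open>The factor is \<open>(A - a)\<^sup>2 + b\<^sup>2\<close>, whose form is at least \<open>b\<^sup>2 \<parallel>x\<parallel>\<^sup>2\<close>. Thus non-real zeros of a polynomial
  never obstruct invertibility, and only real points of the spectrum matter.\<close>

lemma invertible_op_quadratic_factor:
  assumes A: "symmetric_op A" and "b \<noteq> 0"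
  shows "invertible_op (poly_op [:a\<^sup>2 + b\<^sup>2, - 2 * a, 1:] A)"
proof (rule invertible_op_coercive[where m = "b\<^sup>2"])
  define S where "S = poly_op [:- a, 1:] A"
  have S: "symmetric_op S"
    unfolding S_def by (rule poly_op_symmetric[OF A])
  have "[:a\<^sup>2 + b\<^sup>2, - 2 * a, 1:] = [:- a, 1:] * [:- a, 1:] + [:b\<^sup>2:]"
    by (simp add: power2_eq_square)
  then have "poly_op [:a\<^sup>2 + b\<^sup>2, - 2 * a, 1:] A = (S o\<^sub>L S) + b\<^sup>2 *\<^sub>R id_blinfun"
    by (simp only: poly_op_add poly_op_mult poly_op_const S_def)
  then have "inner x (poly_op [:a\<^sup>2 + b\<^sup>2, - 2 * a, 1:] A x) = (norm (S x))\<^sup>2 + b\<^sup>2 * (norm x)\<^sup>2" for x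
    using symmetric_op_inner[OF S, of x "S x"]
    by (simp add: blinfun.add_left blinfun.scaleR_left inner_add power2_norm_eq_inner)
  then show "b\<^sup>2 * (norm x)\<^sup>2 \<le> inner x (poly_op [:a\<^sup>2 + b\<^sup>2, - 2 * a, 1:] A x)" for x
    by simp
qed (use assms poly_op_bounded_ops in \<open>auto simp: symmetric_op_def\<close>)

lemma map_poly_of_real_mult:
  "map_poly complex_of_real (p * q) = map_poly complex_of_real p * map_poly complex_of_real q"
  by (rule poly_eqI) (simp add: coeff_map_poly coeff_mult)

lemma map_poly_of_real_add:
  "map_poly complex_of_real (p + q) = map_poly complex_of_real p + map_poly complex_of_real q"
  by (rule poly_eqI) (simp add: coeff_map_poly)

lemma poly_map_poly_of_real:
  "poly (map_poly complex_of_real p) (complex_of_real t) = complex_of_real (poly p t)"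
  by (induction p) (simp_all add: map_poly_pCons)

text \<open>A real polynomial is a product of linear factors and of quadratic factors
  \<open>(t - a)\<^sup>2 + b\<^sup>2\<close> with \<open>b \<noteq> 0\<close>. One of them can be split off.\<close>

lemma real_poly_factor:
  fixes p :: "real poly"
  assumes "0 < degree p"
  obtains t r where "p = [:- t, 1:] * r"
  | a b r where "b \<noteq> 0" "p = [:a\<^sup>2 + b\<^sup>2, - 2 * a, 1:] * r"
proof -
  let ?c = "map_poly complex_of_real"
  have "degree (?c p) = degree p"
    by (rule degree_map_poly) simp
  then have "\<not> constant (poly (?c p))"
    using assms by (simp add: constant_degree)
  then obtain z where z: "poly (?c p) z = 0"
    using fundamental_theorem_of_algebra by blast
  show thesis
  proof (cases "Im z = 0")
    case True
    then have "z = complex_of_real (Re z)" by (simp add: complex_eq_iff)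
    then have "poly p (Re z) = 0"
      using z poly_map_poly_of_real[of p "Re z"] by simp
    then show thesis
      using that(1) by (metis poly_eq_0_iff_dvd dvdE)
  next
    case False
    define d where "d = [:(Re z)\<^sup>2 + (Im z)\<^sup>2, - 2 * Re z, 1:]"
    have "poly (?c d) z = 0"
      by (simp add: d_def map_poly_pCons complex_eq_iff power2_eq_square algebra_simps)
    moreover have pd: "p = d * (p div d) + p mod d"
      by simp
    ultimately have rem: "poly (?c (p mod d)) z = 0"
      using z by (metis map_poly_of_real_add map_poly_of_real_mult mult_zero_left poly_add poly_mult
          add_0)
    have "degree (p mod d) < 2"
      using degree_mod_less[of d p] by (auto simp: d_def)
    then have "coeff (p mod d) (Suc (Suc n)) = 0" for n
      by (intro coeff_eq_0) simp
    then have "p mod d = [:coeff (p mod d) 0, coeff (p mod d) 1:]"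
      by (intro poly_eqI) (simp add: coeff_pCons split: nat.split)
    then obtain r0 r1 where r: "p mod d = [:r0, r1:]"
      by blast
    have "r1 = 0" "r0 = 0"
      using rem False by (auto simp: r map_poly_pCons complex_eq_iff)
    then show thesis
      using that(2)[OF False, of "Re z" "p div d"] pd r by (simp add: d_def)
  qed
qed

text \<open>Linear factors are invertible because their zeros avoid the spectrum, quadratic ones always are,
  and a product of invertible operators is invertible.\<close>

lemma poly_op_invertible:
  assumes A: "symmetric_op A"
  shows "p \<noteq> 0 \<Longrightarrow> (\<And>t. t \<in> real_spectrum A \<Longrightarrow> poly p t \<noteq> 0) \<Longrightarrow> invertible_op (poly_op p A)"
proof (induction "degree p" arbitrary: p rule: less_induct)
  case less
  show ?case
  proof (cases "degree p = 0")
    case True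
    then obtain c where "p = [:c:]" by (rule degree_eq_zeroE)
    then show ?thesis
      using less.prems(1) by (simp add: poly_op_const invertible_op_scaleR_id)
  next
    case False
    then have "0 < degree p" by simp
    then show ?thesis
    proof (cases rule: real_poly_factor)
      case (1 t r)
      then have "r \<noteq> 0" using less.prems(1) by auto
      then have "degree p = degree [:- t, 1:] + degree r"
        unfolding 1 by (intro degree_mult_eq) auto
      then have "degree r < degree p" by simp
      moreover have "poly r s \<noteq> 0" if "s \<in> real_spectrum A" for s
        using less.prems(2)[OF that] by (auto simp: 1)
      ultimately have "invertible_op (poly_op r A)"
        using less.hyps \<open>r \<noteq> 0\<close> by blast
      moreover have "t \<notin> real_spectrum A"
        using less.prems(2)[of t] by (auto simp: 1)
      then have "invertible_op (poly_op [:- t, 1:] A)"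
        unfolding not_in_real_spectrum_iff poly_op_linear_factor .
      ultimately show ?thesis
        unfolding 1 poly_op_mult by (intro invertible_op_compose)
    next
      case (2 a b r)
      then have "r \<noteq> 0" using less.prems(1) by auto
      then have "degree p = degree [:a\<^sup>2 + b\<^sup>2, - 2 * a, 1:] + degree r"
        unfolding 2(2) by (intro degree_mult_eq) auto
      then have "degree r < degree p" by simp
      moreover have "poly r s \<noteq> 0" if "s \<in> real_spectrum A" for s
        using less.prems(2)[OF that] by (auto simp: 2(2))
      ultimately have "invertible_op (poly_op r A)"
        using less.hyps \<open>r \<noteq> 0\<close> by blast
      then show ?thesis
        unfolding 2(2) poly_op_mult
        by (intro invertible_op_compose invertible_op_quadratic_factor A 2(1))
    qed
  qed
qed

text \<open>If the infimum \<open>s\<close> of the form were not in the spectrum, then \<open>A - s\<close> would be positive and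
  invertible, hence bounded below by some \<open>m > 0\<close>, and \<open>s + m\<close> would still be a lower bound.\<close>

lemma form_infimum_in_spectrum:
  fixes A :: "'h::chilbert_space \<Rightarrow>\<^sub>L 'h"
  assumes A: "symmetric_op A" and "(x :: 'h) \<noteq> 0"
  obtains s where "s \<in> real_spectrum A" "\<And>y. s * (norm y)\<^sup>2 \<le> inner y (A y)"
proof -
  define S where "S = {s. \<forall>y. s * (norm y)\<^sup>2 \<le> inner y (A y)}"
  have S_iff: "s \<in> S \<longleftrightarrow> (\<forall>y. s * (norm y)\<^sup>2 \<le> inner y (A y))" for s
    by (simp add: S_def)
  have "- norm A * (norm y)\<^sup>2 \<le> inner y (A y)" for y
    using abs_inner_blinfun_le[of y A y] by (simp add: power2_eq_square mult.assoc abs_le_iff)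
  then have "S \<noteq> {}"
    using S_iff by blast
  have up: "s \<le> inner y (A y) / (norm y)\<^sup>2" if "s \<in> S" "y \<noteq> 0" for s y
    using that by (simp add: S_def pos_le_divide_eq)
  have bdd: "bdd_above S"
    using up \<open>x \<noteq> 0\<close> by (meson bdd_aboveI)
  have Sup: "Sup S * (norm y)\<^sup>2 \<le> inner y (A y)" for y
  proof (cases "y = 0")
    case False
    then have "Sup S \<le> inner y (A y) / (norm y)\<^sup>2"
      using \<open>S \<noteq> {}\<close> up by (intro cSup_least)
    then show ?thesis using False by (simp add: pos_le_divide_eq)
  qed simp
  have form: "inner y ((A - Sup S *\<^sub>R id_blinfun) y) = inner y (A y) - Sup S * (norm y)\<^sup>2" for y
    by (simp add: blinfun.diff_left blinfun.scaleR_left inner_diff power2_norm_eq_inner)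
  have "Sup S \<in> real_spectrum A"
  proof (rule ccontr)
    assume "Sup S \<notin> real_spectrum A"
    then have "invertible_op (A - Sup S *\<^sub>R id_blinfun)"
      by (simp only: not_in_real_spectrum_iff not_not)
    moreover have "symmetric_op (A - Sup S *\<^sub>R id_blinfun)"
      by (intro symmetric_op_diff symmetric_op_scaleR symmetric_op_id A)
    moreover have "0 \<le> inner y ((A - Sup S *\<^sub>R id_blinfun) y)" for y
      using Sup form by simp
    ultimately obtain m where m: "0 < m"
      "\<And>y. m * (norm y)\<^sup>2 \<le> inner y ((A - Sup S *\<^sub>R id_blinfun) y)"
      using positive_invertible_lower_bound by metis
    then have "Sup S + m \<in> S"
      unfolding S_iff form by (simp add: algebra_simps)
    then have "Sup S + m \<le> Sup S"
      using bdd by (rule cSup_upper)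
    then show False using \<open>0 < m\<close> by simp
  qed
  then show thesis using that Sup by blast
qed

text \<open>The spectral mapping theorem enters here only through the infimum \<open>s\<close> of the form of \<open>p(A)\<close>:
  it belongs to the spectrum of \<open>p(A)\<close>, so \<open>p - s\<close> must have a zero on the spectrum of \<open>A\<close>, and
  \<open>s\<close> is one of the values of \<open>p\<close> there.\<close>

lemma poly_op_nonneg:
  fixes A :: "'h::chilbert_space \<Rightarrow>\<^sub>L 'h"
  assumes A: "symmetric_op A" and nonneg: "\<And>t. t \<in> real_spectrum A \<Longrightarrow> 0 \<le> poly p t"
  shows "0 \<le> inner x (poly_op p A x)"
proof (cases "x = 0")
  case False
  obtain s where s: "s \<in> real_spectrum (poly_op p A)"
      "\<And>y. s * (norm y)\<^sup>2 \<le> inner y (poly_op p A y)"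
    using form_infimum_in_spectrum[OF poly_op_symmetric[OF A] False] by blast
  then have sing: "\<not> invertible_op (poly_op (p - [:s:]) A)"
    using not_in_real_spectrum_iff[of s "poly_op p A"] by (simp add: poly_op_diff poly_op_const)
  have "\<exists>t \<in> real_spectrum A. poly p t = s"
  proof (cases "p = [:s:]")
    case True
    \<comment> \<open>For constant \<open>p\<close> it only matters that the spectrum is not empty.\<close>
    obtain t where "t \<in> real_spectrum A"
      using form_infimum_in_spectrum[OF A False] by blast
    then show ?thesis using True by auto
  next
    case False
    then show ?thesis
      using poly_op_invertible[OF A, of "p - [:s:]"] sing by auto
  qed
  then have "0 \<le> s" using nonneg by auto
  then have "0 \<le> s * (norm x)\<^sup>2" by simp
  then show ?thesis using s(2)[of x] by linarith
qed simp

text \<open>Positivity of \<open>e\<^sup>2 - p\<^sup>2\<close> on the spectrum gives \<open>p(A)\<^sup>2 \<le> e\<^sup>2\<close>, and the form of \<open>p(A)\<^sup>2\<close> is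
  \<open>\<parallel>p(A) x\<parallel>\<^sup>2\<close>.\<close>

lemma norm_poly_op_le:
  assumes A: "symmetric_op A" and "0 \<le> e"
    and bound: "\<And>t. t \<in> real_spectrum A \<Longrightarrow> \<bar>poly p t\<bar> \<le> e"
  shows "norm (poly_op p A) \<le> e"
proof (rule norm_blinfun_bound)
  fix x
  have "0 \<le> inner x (poly_op ([:e\<^sup>2:] - p * p) A x)"
  proof (rule poly_op_nonneg[OF A])
    fix t assume "t \<in> real_spectrum A"
    then have "(poly p t)\<^sup>2 \<le> e\<^sup>2"
      using bound by (metis abs_ge_zero power2_abs power_mono)
    then show "0 \<le> poly ([:e\<^sup>2:] - p * p) t"
      by (simp add: power2_eq_square)
  qed
  also have "\<dots> = e\<^sup>2 * (norm x)\<^sup>2 - (norm (poly_op p A x))\<^sup>2"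
    using symmetric_op_inner[OF poly_op_symmetric[OF A], of p x "poly_op p A x"]
    by (simp add: poly_op_diff poly_op_const poly_op_mult blinfun.diff_left blinfun.scaleR_left
        inner_diff power2_norm_eq_inner)
  finally have "(norm (poly_op p A x))\<^sup>2 \<le> (e * norm x)\<^sup>2"
    by (simp add: power_mult_distrib)
  then show "norm (poly_op p A x) \<le> e * norm x"
    by (rule power2_le_imp_le) (simp add: \<open>0 \<le> e\<close>)
qed fact

lemma real_spectrum_subset:
  assumes "form_between m L A"
  shows "real_spectrum A \<subseteq> {m..L}"
proof
  fix t assume t: "t \<in> real_spectrum A"
  have A: "symmetric_op A" and low: "m * (norm x)\<^sup>2 \<le> inner x (A x)"
    and up: "inner x (A x) \<le> L * (norm x)\<^sup>2" for x
    using assms by (auto simp: form_between_def)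
  have "m \<le> t"
  proof (rule ccontr)
    assume "\<not> m \<le> t"
    moreover have "(m - t) * (norm x)\<^sup>2 \<le> inner x ((A - t *\<^sub>R id_blinfun) x)" for x
      using low[of x]
      by (simp add: blinfun.diff_left blinfun.scaleR_left inner_diff power2_norm_eq_inner
          algebra_simps)
    ultimately have "invertible_op (A - t *\<^sub>R id_blinfun)"
      using A by (intro invertible_op_coercive[where m = "m - t"])
        (auto intro: bounded_ops_diff bounded_ops_scaleR bounded_ops_id symmetric_op_bounded_ops)
    then show False using t not_in_real_spectrum_iff by blast
  qed
  moreover have "t \<le> L"
  proof (rule ccontr)
    assume "\<not> t \<le> L"
    moreover have "(t - L) * (norm x)\<^sup>2 \<le> inner x ((t *\<^sub>R id_blinfun - A) x)" for x
      using up[of x]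
      by (simp add: blinfun.diff_left blinfun.scaleR_left inner_diff power2_norm_eq_inner
          algebra_simps)
    ultimately have "invertible_op (t *\<^sub>R id_blinfun - A)"
      using A by (intro invertible_op_coercive[where m = "t - L"])
        (auto intro: bounded_ops_diff bounded_ops_scaleR bounded_ops_id symmetric_op_bounded_ops)
    then have "invertible_op ((- 1) *\<^sub>R id_blinfun o\<^sub>L (t *\<^sub>R id_blinfun - A))"
      by (intro invertible_op_compose invertible_op_scaleR_id) simp_all
    also have "(- 1) *\<^sub>R id_blinfun o\<^sub>L (t *\<^sub>R id_blinfun - A) = A - t *\<^sub>R id_blinfun"
      by (rule blinfun_eqI) (simp add: blinfun.diff_left blinfun.scaleR_left blinfun.minus_left)
    finally show False using t not_in_real_spectrum_iff by blast
  qed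
  ultimately show "t \<in> {m..L}" by simp
qed

section \<open>Continuous functional calculus on an interval\<close>

lemma uniform_real_poly_approx:
  fixes f :: "real \<Rightarrow> real"
  assumes "continuous_on {m..L} f"
  obtains p :: "nat \<Rightarrow> real poly" where "uniform_limit {m..L} (\<lambda>n. poly (p n)) f sequentially"
proof -
  have "\<exists>p :: real poly. \<forall>t\<in>{m..L}. \<bar>f t - poly p t\<bar> < e" if "e > 0" for e
  proof -
    obtain g where g: "real_polynomial_function g" "\<And>t. t \<in> {m..L} \<Longrightarrow> \<bar>f t - g t\<bar> < e"
      using Stone_Weierstrass_real_polynomial_function[OF compact_Icc assms \<open>e > 0\<close>] by blast
    then obtain a n where "g = (\<lambda>x. \<Sum>i\<le>n. a i * x ^ i)"
      using real_polynomial_function_iff_sum by blast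
    then have "poly (\<Sum>i\<le>n. monom (a i) i) t = g t" for t
      by (simp add: poly_sum poly_monom)
    then show ?thesis using g(2) by metis
  qed
  then have "\<forall>n. \<exists>p :: real poly. \<forall>t\<in>{m..L}. \<bar>f t - poly p t\<bar> < inverse (real (Suc n))"
    by (simp del: of_nat_Suc)
  then obtain p :: "nat \<Rightarrow> real poly"
    where p: "\<And>n t. t \<in> {m..L} \<Longrightarrow> \<bar>f t - poly (p n) t\<bar> < inverse (real (Suc n))"
    by metis
  have "uniform_limit {m..L} (\<lambda>n. poly (p n)) f sequentially"
  proof (rule uniform_limitI)
    fix e :: real assume "e > 0"
    then have "\<forall>\<^sub>F n in sequentially. inverse (real (Suc n)) < e"
      using LIMSEQ_inverse_real_of_nat by (simp add: order_tendsto_iff)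
    then show "\<forall>\<^sub>F n in sequentially. \<forall>t\<in>{m..L}. dist (poly (p n) t) (f t) < e"
    proof eventually_elim
      case (elim n)
      then show ?case
        using p[of _ n] by (metis abs_minus_commute dist_real_def less_trans)
    qed
  qed
  then show thesis by (rule that)
qed

text \<open>Polynomials that are uniformly close on the spectrum give operators that are close in norm, so
  the definite description in the definition of the functional calculus is satisfied.\<close>

lemma poly_op_tendsto_cfc:
  fixes A :: "'h::chilbert_space \<Rightarrow>\<^sub>L 'h"
  assumes A: "form_between m L A"
    and p: "uniform_limit {m..L} (\<lambda>n. poly (p n)) f sequentially"
  shows "(\<lambda>n. poly_op (p n) A) \<longlonglongrightarrow> cfc f A"
proof -
  have S: "symmetric_op A" using A by (rule form_between_symmetric)
  have pS: "uniform_limit (real_spectrum A) (\<lambda>n. poly (p n)) f sequentially"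
    using p real_spectrum_subset[OF A] by (rule uniform_limit_on_subset)
  have close: "\<forall>\<^sub>F n in sequentially. \<forall>t\<in>real_spectrum A. \<bar>poly (r n) t - f t\<bar> < e"
    if "uniform_limit (real_spectrum A) (\<lambda>n. poly (r n)) f sequentially" "e > 0"
    for r :: "nat \<Rightarrow> real poly" and e
    using uniform_limitD[OF that] by (simp add: dist_real_def)
  have "Cauchy (\<lambda>n. poly_op (p n) A)"
  proof (rule CauchyI)
    fix e :: real assume "e > 0"
    then obtain N where N: "\<And>n t. n \<ge> N \<Longrightarrow> t \<in> real_spectrum A \<Longrightarrow> \<bar>poly (p n) t - f t\<bar> < e / 3"
      using close[OF pS, of "e / 3"] by (auto simp: eventually_sequentially)
    have "norm (poly_op (p n) A - poly_op (p k) A) < e" if "n \<ge> N" "k \<ge> N" for n k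
    proof -
      have "norm (poly_op (p n - p k) A) \<le> e / 3 + e / 3"
      proof (rule norm_poly_op_le[OF S])
        fix t assume "t \<in> real_spectrum A"
        then show "\<bar>poly (p n - p k) t\<bar> \<le> e / 3 + e / 3"
          unfolding poly_diff using N[of n t] N[of k t] that by linarith
      qed (use \<open>e > 0\<close> in simp)
      then show ?thesis using \<open>e > 0\<close> by (simp add: poly_op_diff)
    qed
    then show "\<exists>N. \<forall>n\<ge>N. \<forall>k\<ge>N. norm (poly_op (p n) A - poly_op (p k) A) < e"
      by blast
  qed
  then obtain B where B: "(\<lambda>n. poly_op (p n) A) \<longlonglongrightarrow> B"
    using Cauchy_convergent_iff convergent_def by blast
  have all: "(\<lambda>n. poly_op (q n) A) \<longlonglongrightarrow> B"
    if q: "uniform_limit (real_spectrum A) (\<lambda>n. poly (q n)) f sequentially"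
    for q :: "nat \<Rightarrow> real poly"
  proof -
    have "(\<lambda>n. poly_op (q n) A - poly_op (p n) A) \<longlonglongrightarrow> 0"
    proof (rule tendstoI)
      fix e :: real assume "e > 0"
      then have e3: "e / 3 > 0" by simp
      show "\<forall>\<^sub>F n in sequentially. dist (poly_op (q n) A - poly_op (p n) A) 0 < e"
        using close[OF q e3] close[OF pS e3]
      proof eventually_elim
        case (elim n)
        have "norm (poly_op (q n - p n) A) \<le> e / 3 + e / 3"
          using \<open>e > 0\<close>
        proof (intro norm_poly_op_le[OF S])
          fix t assume "t \<in> real_spectrum A"
          then have "\<bar>poly (q n) t - f t\<bar> < e / 3" "\<bar>poly (p n) t - f t\<bar> < e / 3"
            using elim by blast+
          then show "\<bar>poly (q n - p n) t\<bar> \<le> e / 3 + e / 3"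
            unfolding poly_diff by linarith
        qed simp
        then show ?case using \<open>e > 0\<close> by (simp add: poly_op_diff)
      qed
    qed
    from tendsto_add[OF this B] show ?thesis by simp
  qed
  have "cfc f A = B"
    unfolding cfc_def
  proof (rule the_equality)
    show "C = B" if "\<forall>q. uniform_limit (real_spectrum A) (\<lambda>n. poly (q n)) f sequentially
        \<longrightarrow> (\<lambda>n. poly_op (q n) A) \<longlonglongrightarrow> C" for C
      using that pS B LIMSEQ_unique by blast
  qed (use all in blast)
  then show ?thesis using B by simp
qed

lemma tendsto_inner_blinfun:
  "(X \<longlongrightarrow> (A :: 'h::real_inner \<Rightarrow>\<^sub>L 'h)) F \<Longrightarrow> ((\<lambda>n. inner y (X n x)) \<longlongrightarrow> inner y (A x)) F"
  by (intro tendsto_intros)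

lemma cfc_symmetric:
  fixes A :: "'h::chilbert_space \<Rightarrow>\<^sub>L 'h"
  assumes A: "form_between m L A" and f: "continuous_on {m..L} f"
  shows "symmetric_op (cfc f A)"
proof -
  obtain p where "uniform_limit {m..L} (\<lambda>n. poly (p n)) f sequentially"
    using uniform_real_poly_approx[OF f] .
  then have lim: "(\<lambda>n. poly_op (p n) A) \<longlonglongrightarrow> cfc f A"
    by (rule poly_op_tendsto_cfc[OF A])
  have sym: "symmetric_op (poly_op (p n) A)" for n
    by (rule poly_op_symmetric[OF form_between_symmetric[OF A]])
  have "cfc f A (c *\<^sub>C x) = c *\<^sub>C cfc f A x" for c x
  proof (rule LIMSEQ_unique)
    show "(\<lambda>n. poly_op (p n) A (c *\<^sub>C x)) \<longlonglongrightarrow> cfc f A (c *\<^sub>C x)"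
      by (intro tendsto_intros lim)
    have "(\<lambda>n. c *\<^sub>C poly_op (p n) A x) \<longlonglongrightarrow> c *\<^sub>C cfc f A x"
      by (intro bounded_linear.tendsto[OF bounded_linear_scaleC] tendsto_intros lim)
    then show "(\<lambda>n. poly_op (p n) A (c *\<^sub>C x)) \<longlonglongrightarrow> c *\<^sub>C cfc f A x"
      using sym by (simp add: symmetric_op_def bounded_ops_def)
  qed
  moreover have "inner (cfc f A x) y = inner x (cfc f A y)" for x y
  proof (rule LIMSEQ_unique)
    show "(\<lambda>n. inner x (poly_op (p n) A y)) \<longlonglongrightarrow> inner (cfc f A x) y"
      using tendsto_inner_blinfun[OF lim, of y x] sym
      by (simp add: symmetric_op_def inner_commute)
  qed (rule tendsto_inner_blinfun[OF lim])
  ultimately show ?thesis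
    by (simp add: symmetric_op_def bounded_ops_def)
qed

text \<open>The error bound depends only on the interval and not on the operator. This uniformity makes the
  calculus continuous in the operator argument.\<close>

lemma norm_cfc_diff_poly_op_le:
  fixes A :: "'h::chilbert_space \<Rightarrow>\<^sub>L 'h"
  assumes A: "form_between m L A" and f: "continuous_on {m..L} f" and "0 \<le> e"
    and bound: "\<And>t. t \<in> {m..L} \<Longrightarrow> \<bar>f t - poly q t\<bar> \<le> e"
  shows "norm (cfc f A - poly_op q A) \<le> e"
proof (rule field_le_epsilon)
  fix d :: real assume "0 < d"
  obtain p where p: "uniform_limit {m..L} (\<lambda>n. poly (p n)) f sequentially"
    using uniform_real_poly_approx[OF f] .
  have "(\<lambda>n. norm (poly_op (p n) A - poly_op q A)) \<longlonglongrightarrow> norm (cfc f A - poly_op q A)"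
    by (intro tendsto_intros poly_op_tendsto_cfc[OF A p])
  moreover have "\<forall>\<^sub>F n in sequentially. norm (poly_op (p n) A - poly_op q A) \<le> e + d"
    using uniform_limitD[OF p \<open>0 < d\<close>]
  proof eventually_elim
    case (elim n)
    have "norm (poly_op (p n - q) A) \<le> e + d"
    proof (rule norm_poly_op_le[OF form_between_symmetric[OF A]])
      fix t assume "t \<in> real_spectrum A"
      then have "t \<in> {m..L}" using real_spectrum_subset[OF A] by blast
      then have "\<bar>poly (p n) t - f t\<bar> < d" "\<bar>f t - poly q t\<bar> \<le> e"
        using elim bound by (auto simp: dist_real_def)
      then show "\<bar>poly (p n - q) t\<bar> \<le> e + d" unfolding poly_diff by linarith
    qed (use \<open>0 \<le> e\<close> \<open>0 < d\<close> in simp)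
    then show ?case by (simp add: poly_op_diff)
  qed
  ultimately show "norm (cfc f A - poly_op q A) \<le> e + d"
    by (rule tendsto_upperbound) simp
qed

lemma cfc_nonneg:
  fixes A :: "'h::chilbert_space \<Rightarrow>\<^sub>L 'h"
  assumes A: "form_between m L A" and f: "continuous_on {m..L} f"
    and nonneg: "\<And>t. t \<in> {m..L} \<Longrightarrow> 0 \<le> f t"
  shows "0 \<le> inner x (cfc f A x)"
proof -
  obtain p where p: "uniform_limit {m..L} (\<lambda>n. poly (p n)) f sequentially"
    using uniform_real_poly_approx[OF f] .
  have "- e \<le> inner x (cfc f A x)" if "0 < e" for e
  proof -
    define d where "d = e / ((norm x)\<^sup>2 + 1)"
    have "0 < d" using \<open>0 < e\<close> by (simp add: d_def add_nonneg_pos)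
    have "\<forall>\<^sub>F n in sequentially. - (d * (norm x)\<^sup>2) \<le> inner x (poly_op (p n) A x)"
      using uniform_limitD[OF p \<open>0 < d\<close>]
    proof eventually_elim
      case (elim n)
      have "0 \<le> inner x (poly_op (p n + [:d:]) A x)"
      proof (rule poly_op_nonneg[OF form_between_symmetric[OF A]])
        fix t assume "t \<in> real_spectrum A"
        then have "t \<in> {m..L}" using real_spectrum_subset[OF A] by blast
        then have "\<bar>poly (p n) t - f t\<bar> < d" "0 \<le> f t"
          using elim nonneg by (auto simp: dist_real_def)
        then show "0 \<le> poly (p n + [:d:]) t" by simp
      qed
      then show ?case
        by (simp add: poly_op_add poly_op_const blinfun.add_left blinfun.scaleR_left inner_add
            power2_norm_eq_inner)
    qed
    then have "- (d * (norm x)\<^sup>2) \<le> inner x (cfc f A x)"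
      by (intro tendsto_lowerbound[OF tendsto_inner_blinfun[OF poly_op_tendsto_cfc[OF A p]]]) simp_all
    moreover have "d * (norm x)\<^sup>2 \<le> d * ((norm x)\<^sup>2 + 1)"
      using \<open>0 < d\<close> by simp
    moreover have "d * ((norm x)\<^sup>2 + 1) = e"
      unfolding d_def by (simp add: add_nonneg_eq_0_iff)
    ultimately show ?thesis by linarith
  qed
  from this[of "- inner x (cfc f A x) / 2"] show ?thesis
    by linarith
qed

lemma tendsto_cfc:
  fixes B :: "'h::chilbert_space \<Rightarrow>\<^sub>L 'h"
  assumes A: "\<And>n. form_between m L (A n)" and B: "form_between m L B"
    and f: "continuous_on {m..L} f" and lim: "A \<longlonglongrightarrow> B"
  shows "(\<lambda>n. cfc f (A n)) \<longlonglongrightarrow> cfc f B"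
proof (rule tendstoI)
  fix e :: real assume "0 < e"
  then have e3: "0 < e / 3" by simp
  obtain p where "uniform_limit {m..L} (\<lambda>n. poly (p n)) f sequentially"
    using uniform_real_poly_approx[OF f] .
  from eventually_happens[OF uniform_limitD[OF this e3]] obtain k
    where "\<forall>t\<in>{m..L}. dist (poly (p k) t) (f t) < e / 3"
    by auto
  then have pk: "\<bar>f t - poly (p k) t\<bar> \<le> e / 3" if "t \<in> {m..L}" for t
    using that by (force simp: dist_real_def abs_minus_commute)
  have "(\<lambda>n. poly_op (p k) (A n)) \<longlonglongrightarrow> poly_op (p k) B"
    by (rule tendsto_poly_op[OF lim])
  then have "\<forall>\<^sub>F n in sequentially. dist (poly_op (p k) (A n)) (poly_op (p k) B) < e / 3"
    using e3 by (rule tendstoD)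
  then show "\<forall>\<^sub>F n in sequentially. dist (cfc f (A n)) (cfc f B) < e"
  proof eventually_elim
    case (elim n)
    have 1: "dist (cfc f (A n)) (poly_op (p k) (A n)) \<le> e / 3"
      unfolding dist_norm by (rule norm_cfc_diff_poly_op_le[OF A f _ pk]) (use e3 in simp_all)
    have 2: "dist (cfc f B) (poly_op (p k) B) \<le> e / 3"
      unfolding dist_norm by (rule norm_cfc_diff_poly_op_le[OF B f _ pk]) (use e3 in simp_all)
    have "dist (cfc f (A n)) (cfc f B) \<le> dist (cfc f (A n)) (poly_op (p k) (A n))
        + dist (poly_op (p k) (A n)) (poly_op (p k) B) + dist (cfc f B) (poly_op (p k) B)"
      using dist_triangle[of "cfc f (A n)" "cfc f B" "poly_op (p k) (A n)"]
        dist_triangle2[of "poly_op (p k) (A n)" "cfc f B" "poly_op (p k) B"]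
      by linarith
    then show ?case using 1 2 elim by linarith
  qed
qed

section \<open>Orthonormal families\<close>

lemma cinner_scaleC_left: "cinner (c *\<^sub>C x) y = cnj c * cinner x y"
  for x y :: "'h::chilbert_space"
  by (metis cinner_commute cinner_scaleC_right complex_cnj_mult complex_cnj_cnj)

lemma cinner_zero_right [simp]: "cinner x 0 = 0" for x :: "'h::chilbert_space"
  using cinner_add_right[of x 0 0] by simp

lemma cinner_sum_right: "cinner x (sum g F) = (\<Sum>i\<in>F. cinner x (g i))" for x :: "'h::chilbert_space"
  by (induction F rule: infinite_finite_induct) (simp_all add: cinner_add_right)

lemma cmod_cinner_le: "cmod (cinner x y) \<le> norm x * norm y" for x y :: "'h::chilbert_space"
proof -
  define c where "c = cinner x y"
  have "cinner x (cnj c *\<^sub>C y) = of_real ((cmod c)\<^sup>2)"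
    using complex_norm_square[of c] by (simp add: cinner_scaleC_right c_def mult.commute)
  then have "(cmod c)\<^sup>2 = inner x (cnj c *\<^sub>C y)"
    by (simp add: Re_cinner[symmetric])
  also have "\<dots> \<le> norm x * (cmod c * norm y)"
    using norm_cauchy_schwarz[of x "cnj c *\<^sub>C y"] by (simp add: norm_scaleC)
  finally have "cmod c * cmod c \<le> cmod c * (norm x * norm y)"
    by (simp add: power2_eq_square mult_ac)
  then show ?thesis
    by (cases "c = 0") (auto simp: c_def)
qed

lemma bounded_linear_cinner: "bounded_linear (cinner x)" for x :: "'h::chilbert_space"
proof (rule bounded_linear_intro[where K = "norm x"])
  show "cinner x (r *\<^sub>R y) = r *\<^sub>R cinner x y" for r y
    by (simp add: scaleC_of_real[symmetric] cinner_scaleC_right scaleR_conv_of_real)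
  show "norm (cinner x y) \<le> norm y * norm x" for y
    using cmod_cinner_le[of x y] by (simp add: mult.commute)
qed (rule cinner_add_right)

lemma cinner_scaleR_right: "cinner x (r *\<^sub>R y) = of_real r * cinner x y"
  for x y :: "'h::chilbert_space"
  by (simp add: scaleC_of_real[symmetric] cinner_scaleC_right)

lemma cinner_diff_right: "cinner x (y - z) = cinner x y - cinner x z" for x :: "'h::chilbert_space"
  by (rule linear_diff[OF bounded_linear.linear[OF bounded_linear_cinner]])

definition orthonormal_on :: "'i set \<Rightarrow> ('i \<Rightarrow> 'h::chilbert_space) \<Rightarrow> bool" where
  "orthonormal_on I \<phi> \<longleftrightarrow> (\<forall>i\<in>I. \<forall>j\<in>I. cinner (\<phi> i) (\<phi> j) = (if i = j then 1 else 0))"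

lemma cinner_orthonormal:
  "orthonormal_on I \<phi> \<Longrightarrow> i \<in> I \<Longrightarrow> j \<in> I \<Longrightarrow> cinner (\<phi> i) (\<phi> j) = (if i = j then 1 else 0)"
  by (simp add: orthonormal_on_def)

lemma norm_orthonormal_sum:
  assumes "orthonormal_on I \<phi>" "finite F" "F \<subseteq> I"
  shows "(norm (\<Sum>i\<in>F. c i *\<^sub>C \<phi> i))\<^sup>2 = (\<Sum>i\<in>F. (cmod (c i))\<^sup>2)"
  using assms(2,3)
proof (induction F rule: finite_induct)
  case (insert j F)
  have "cinner (c j *\<^sub>C \<phi> j) (\<Sum>i\<in>F. c i *\<^sub>C \<phi> i) = (\<Sum>i\<in>F. cnj (c j) * c i * cinner (\<phi> j) (\<phi> i))"
    by (simp add: cinner_sum_right cinner_scaleC_left cinner_scaleC_right sum_distrib_left mult_ac)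
  also have "\<dots> = 0"
  proof (intro sum.neutral ballI)
    fix i assume "i \<in> F"
    then have "cinner (\<phi> j) (\<phi> i) = 0"
      using insert.hyps(2) insert.prems cinner_orthonormal[OF assms(1), of j i] by auto
    then show "cnj (c j) * c i * cinner (\<phi> j) (\<phi> i) = 0" by simp
  qed
  finally have "inner (c j *\<^sub>C \<phi> j) (\<Sum>i\<in>F. c i *\<^sub>C \<phi> i) = 0"
    by (simp add: Re_cinner[symmetric])
  moreover have "(norm (\<phi> j))\<^sup>2 = 1"
    using cinner_orthonormal[OF assms(1), of j j] insert.prems
    by (simp add: cinner_self flip: of_real_power)
  ultimately show ?case
    using insert norm_add_Pythagorean[of "c j *\<^sub>C \<phi> j" "\<Sum>i\<in>F. c i *\<^sub>C \<phi> i"]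
    by (simp add: orthogonal_def norm_scaleC power_mult_distrib)
qed simp

lemma bessel_inequality:
  assumes "orthonormal_on I \<phi>" "finite F" "F \<subseteq> I"
  shows "(\<Sum>i\<in>F. (cmod (cinner (\<phi> i) x))\<^sup>2) \<le> (norm x)\<^sup>2"
proof -
  define s where "s = (\<Sum>i\<in>F. cinner (\<phi> i) x *\<^sub>C \<phi> i)"
  define b where "b = (\<Sum>i\<in>F. (cmod (cinner (\<phi> i) x))\<^sup>2)"
  have "cinner x s = (\<Sum>i\<in>F. of_real ((cmod (cinner (\<phi> i) x))\<^sup>2))"
    unfolding s_def cinner_sum_right
  proof (rule sum.cong[OF refl])
    show "cinner x (cinner (\<phi> i) x *\<^sub>C \<phi> i) = of_real ((cmod (cinner (\<phi> i) x))\<^sup>2)" for i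
      using complex_norm_square[of "cinner (\<phi> i) x"] cinner_commute[of x "\<phi> i"]
      by (simp add: cinner_scaleC_right)
  qed
  then have "cinner x s = of_real b"
    by (simp add: b_def)
  then have xs: "inner x s = b"
    by (simp add: Re_cinner[symmetric])
  have "(norm s)\<^sup>2 = b"
    unfolding s_def b_def by (rule norm_orthonormal_sum[OF assms])
  then have "(norm (x - s))\<^sup>2 = (norm x)\<^sup>2 - b"
    using xs by (simp add: power2_norm_eq_inner inner_diff inner_commute)
  then show ?thesis
    using zero_le_power2[of "norm (x - s)"] by (simp add: b_def)
qed

lemma bessel_summable:
  assumes "orthonormal_on I \<phi>"
  shows "(\<lambda>i. (cmod (cinner (\<phi> i) x))\<^sup>2) summable_on I"
proof (rule nonneg_bdd_above_summable_on)
  show "bdd_above (sum (\<lambda>i. (cmod (cinner (\<phi> i) x))\<^sup>2) ` {F. F \<subseteq> I \<and> finite F})"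
    by (rule bdd_aboveI2[where M = "(norm x)\<^sup>2"]) (simp add: bessel_inequality[OF assms])
qed simp

text \<open>Tails of the series are controlled in norm by tails of \<open>\<Sum> \<bar>c\<^sub>i\<bar>\<^sup>2\<close>, by Pythagoras. The series need not
  converge absolutely, so the Cauchy criterion is verified directly.\<close>

lemma orthonormal_summable:
  fixes \<phi> :: "'i \<Rightarrow> 'h::chilbert_space"
  assumes \<phi>: "orthonormal_on I \<phi>" and c: "(\<lambda>i. (cmod (c i))\<^sup>2) summable_on I"
  shows "(\<lambda>i. c i *\<^sub>C \<phi> i) summable_on I"
proof -
  let ?s = "sum (\<lambda>i. (cmod (c i))\<^sup>2)" and ?v = "sum (\<lambda>i. c i *\<^sub>C \<phi> i)"
  obtain l where l: "(?s \<longlongrightarrow> l) (finite_subsets_at_top I)"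
    using c unfolding summable_on_def has_sum_def by blast
  have "\<exists>P. eventually P (finite_subsets_at_top I) \<and> (\<forall>F G. P F \<and> P G \<longrightarrow> dist (?v F) (?v G) < e)"
    if "e > 0" for e
  proof -
    define d where "d = (e / 2)\<^sup>2 / 2"
    have "d > 0" using \<open>e > 0\<close> by (simp add: d_def)
    then have "eventually (\<lambda>F. dist (?s F) l < d) (finite_subsets_at_top I)"
      by (rule tendstoD[OF l])
    then obtain H where H: "finite H" "H \<subseteq> I"
      and "\<forall>F. finite F \<and> H \<subseteq> F \<and> F \<subseteq> I \<longrightarrow> dist (?s F) l < d"
      unfolding eventually_finite_subsets_at_top by (elim exE conjE)
    then have close: "dist (?s F) l < d" if "finite F" "H \<subseteq> F" "F \<subseteq> I" for F
      using that by simp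
    have near: "dist (?v F) (?v H) < e / 2" if F: "finite F" "H \<subseteq> F" "F \<subseteq> I" for F
    proof -
      have "?v F - ?v H = ?v (F - H)" "?s F - ?s H = ?s (F - H)"
        using F by (simp_all add: sum_diff)
      moreover have "(norm (?v (F - H)))\<^sup>2 = ?s (F - H)"
        using F by (intro norm_orthonormal_sum[OF \<phi>]) auto
      moreover have "?s F - ?s H < d + d"
        using close[OF F] close[OF H(1) order_refl H(2)] by (simp add: dist_real_def abs_less_iff)
      ultimately have "(norm (?v F - ?v H))\<^sup>2 < (e / 2)\<^sup>2"
        by (simp add: d_def)
      then show ?thesis
        unfolding dist_norm by (rule power_less_imp_less_base) (use \<open>e > 0\<close> in simp)
    qed
    define P where "P F \<longleftrightarrow> finite F \<and> H \<subseteq> F \<and> F \<subseteq> I" for F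
    have "eventually P (finite_subsets_at_top I)"
      unfolding eventually_finite_subsets_at_top P_def using H by blast
    moreover have "dist (?v F) (?v G) < e" if "P F" "P G" for F G
      using that near[of F] near[of G] dist_triangle2[of "?v F" "?v G" "?v H"]
      unfolding P_def by linarith
    ultimately show ?thesis by blast
  qed
  then have "cauchy_filter (filtermap ?v (finite_subsets_at_top I))"
    by (simp add: cauchy_filter_metric_filtermap)
  moreover have "complete (UNIV :: 'h set)"
    by (rule complete_UNIV)
  ultimately obtain w where "(?v \<longlongrightarrow> w) (finite_subsets_at_top I)"
    using complete_uniform[where S = "UNIV :: 'h set"] by (force simp add: filterlim_def)
  then show ?thesis
    using summable_on_def has_sum_def by blast
qed

text \<open>The partial isometry that carries the coordinates with respect to \<open>\<phi>\<close> over to \<open>\<psi>\<close>.\<close>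

definition transfer_map ::
    "'i set \<Rightarrow> ('i \<Rightarrow> 'h::chilbert_space) \<Rightarrow> ('i \<Rightarrow> 'h) \<Rightarrow> 'h \<Rightarrow>\<^sub>L 'h" where
  "transfer_map I \<phi> \<psi> = Blinfun (\<lambda>x. \<Sum>\<^sub>\<infinity>i\<in>I. cinner (\<phi> i) x *\<^sub>C \<psi> i)"

context
  fixes I :: "'i set" and \<phi> \<psi> :: "'i \<Rightarrow> 'h::chilbert_space"
  assumes \<phi>: "orthonormal_on I \<phi>" and \<psi>: "orthonormal_on I \<psi>"
begin

lemma has_sum_transfer_aux:
  "((\<lambda>i. cinner (\<phi> i) x *\<^sub>C \<psi> i) has_sum (\<Sum>\<^sub>\<infinity>i\<in>I. cinner (\<phi> i) x *\<^sub>C \<psi> i)) I"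
  by (intro has_sum_infsum orthonormal_summable[OF \<psi>] bessel_summable[OF \<phi>])

lemma transfer_map_apply: "transfer_map I \<phi> \<psi> x = (\<Sum>\<^sub>\<infinity>i\<in>I. cinner (\<phi> i) x *\<^sub>C \<psi> i)"
proof -
  have "bounded_linear (\<lambda>x. \<Sum>\<^sub>\<infinity>i\<in>I. cinner (\<phi> i) x *\<^sub>C \<psi> i)"
  proof (rule bounded_linear_intro[where K = 1])
    fix x y :: 'h and r :: real
    have "((\<lambda>i. cinner (\<phi> i) (x + y) *\<^sub>C \<psi> i) has_sum
        ((\<Sum>\<^sub>\<infinity>i\<in>I. cinner (\<phi> i) x *\<^sub>C \<psi> i) + (\<Sum>\<^sub>\<infinity>i\<in>I. cinner (\<phi> i) y *\<^sub>C \<psi> i))) I"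
      unfolding cinner_add_right scaleC_add_left by (intro has_sum_add has_sum_transfer_aux)
    then show "(\<Sum>\<^sub>\<infinity>i\<in>I. cinner (\<phi> i) (x + y) *\<^sub>C \<psi> i) =
        (\<Sum>\<^sub>\<infinity>i\<in>I. cinner (\<phi> i) x *\<^sub>C \<psi> i) + (\<Sum>\<^sub>\<infinity>i\<in>I. cinner (\<phi> i) y *\<^sub>C \<psi> i)"
      by (rule infsumI)
    have "((\<lambda>i. r *\<^sub>R (cinner (\<phi> i) x *\<^sub>C \<psi> i)) has_sum
        (r *\<^sub>R (\<Sum>\<^sub>\<infinity>i\<in>I. cinner (\<phi> i) x *\<^sub>C \<psi> i))) I"
      by (intro has_sum_bounded_linear[OF bounded_linear_scaleR_right] has_sum_transfer_aux)
    moreover have "r *\<^sub>R (cinner (\<phi> i) x *\<^sub>C \<psi> i) = cinner (\<phi> i) (r *\<^sub>R x) *\<^sub>C \<psi> i" for i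
      by (simp add: scaleC_of_real[symmetric] cinner_scaleC_right scaleC_scaleC)
    ultimately show "(\<Sum>\<^sub>\<infinity>i\<in>I. cinner (\<phi> i) (r *\<^sub>R x) *\<^sub>C \<psi> i) =
        r *\<^sub>R (\<Sum>\<^sub>\<infinity>i\<in>I. cinner (\<phi> i) x *\<^sub>C \<psi> i)"
      by (intro infsumI) simp
    show "norm (\<Sum>\<^sub>\<infinity>i\<in>I. cinner (\<phi> i) x *\<^sub>C \<psi> i) \<le> norm x * 1"
    proof (rule tendsto_upperbound)
      show "((\<lambda>F. norm (\<Sum>i\<in>F. cinner (\<phi> i) x *\<^sub>C \<psi> i)) \<longlongrightarrow>
          norm (\<Sum>\<^sub>\<infinity>i\<in>I. cinner (\<phi> i) x *\<^sub>C \<psi> i)) (finite_subsets_at_top I)"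
        using has_sum_transfer_aux[of x] unfolding has_sum_def by (intro tendsto_norm)
      have "norm (\<Sum>i\<in>F. cinner (\<phi> i) x *\<^sub>C \<psi> i) \<le> norm x" if "finite F" "F \<subseteq> I" for F
      proof (rule power2_le_imp_le)
        show "(norm (\<Sum>i\<in>F. cinner (\<phi> i) x *\<^sub>C \<psi> i))\<^sup>2 \<le> (norm x)\<^sup>2"
          using norm_orthonormal_sum[OF \<psi> that] bessel_inequality[OF \<phi> that] by simp
      qed simp
      then show "\<forall>\<^sub>F F in finite_subsets_at_top I.
          norm (\<Sum>i\<in>F. cinner (\<phi> i) x *\<^sub>C \<psi> i) \<le> norm x * 1"
        by (intro eventually_finite_subsets_at_top_weakI) simp
    qed simp
  qed
  then show ?thesis
    by (simp add: transfer_map_def bounded_linear_Blinfun_apply)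
qed

lemma has_sum_transfer_map: "((\<lambda>i. cinner (\<phi> i) x *\<^sub>C \<psi> i) has_sum transfer_map I \<phi> \<psi> x) I"
  using has_sum_transfer_aux by (simp only: transfer_map_apply)

lemma transfer_map_bounded_ops: "transfer_map I \<phi> \<psi> \<in> bounded_ops"
proof -
  have "((\<lambda>i. cinner (\<phi> i) (c *\<^sub>C x) *\<^sub>C \<psi> i) has_sum c *\<^sub>C transfer_map I \<phi> \<psi> x) I" for c x
    using has_sum_bounded_linear[OF bounded_linear_scaleC has_sum_transfer_map]
    by (simp add: cinner_scaleC_right scaleC_scaleC)
  then show ?thesis
    unfolding bounded_ops_def using has_sum_transfer_map has_sum_unique by blast
qed

lemma cinner_transfer_map:
  assumes "j \<in> I"
  shows "cinner (\<psi> j) (transfer_map I \<phi> \<psi> x) = cinner (\<phi> j) x"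
proof -
  have "((\<lambda>i. cinner (\<psi> j) (cinner (\<phi> i) x *\<^sub>C \<psi> i)) has_sum
      cinner (\<psi> j) (transfer_map I \<phi> \<psi> x)) I"
    by (rule has_sum_bounded_linear[OF bounded_linear_cinner has_sum_transfer_map])
  moreover have "((\<lambda>i. cinner (\<psi> j) (cinner (\<phi> i) x *\<^sub>C \<psi> i)) has_sum cinner (\<phi> j) x) I"
    using assms cinner_orthonormal[OF \<psi> assms]
    by (intro has_sum_finite_neutralI[where B = "{j}"]) (auto simp: cinner_scaleC_right)
  ultimately show ?thesis by (rule has_sum_unique)
qed

lemma cinner_transfer_map_orthogonal:
  assumes "\<And>i. i \<in> I \<Longrightarrow> cinner y (\<psi> i) = 0"
  shows "cinner y (transfer_map I \<phi> \<psi> x) = 0"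
proof -
  have "((\<lambda>i. cinner y (cinner (\<phi> i) x *\<^sub>C \<psi> i)) has_sum cinner y (transfer_map I \<phi> \<psi> x)) I"
    by (rule has_sum_bounded_linear[OF bounded_linear_cinner has_sum_transfer_map])
  moreover have "((\<lambda>i. cinner y (cinner (\<phi> i) x *\<^sub>C \<psi> i)) has_sum 0) I"
    using assms by (intro has_sum_0) (simp add: cinner_scaleC_right)
  ultimately show ?thesis by (rule has_sum_unique)
qed

end

lemma transfer_map_adjoint:
  assumes \<phi>: "orthonormal_on I \<phi>" and \<psi>: "orthonormal_on I \<psi>"
  shows "inner (transfer_map I \<phi> \<psi> x) y = inner x (transfer_map I \<psi> \<phi> y)"
proof -
  have "((\<lambda>i. inner y (cinner (\<phi> i) x *\<^sub>C \<psi> i)) has_sum inner y (transfer_map I \<phi> \<psi> x)) I"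
    by (rule has_sum_bounded_linear[OF bounded_linear_inner_right has_sum_transfer_map[OF \<phi> \<psi>]])
  moreover have "((\<lambda>i. inner x (cinner (\<psi> i) y *\<^sub>C \<phi> i)) has_sum inner x (transfer_map I \<psi> \<phi> y)) I"
    by (rule has_sum_bounded_linear[OF bounded_linear_inner_right has_sum_transfer_map[OF \<psi> \<phi>]])
  moreover have "inner y (cinner (\<phi> i) x *\<^sub>C \<psi> i) = inner x (cinner (\<psi> i) y *\<^sub>C \<phi> i)" for i
  proof -
    have "cinner y (cinner (\<phi> i) x *\<^sub>C \<psi> i) = cnj (cinner x (cinner (\<psi> i) y *\<^sub>C \<phi> i))"
      using cinner_commute[of y "\<psi> i"] cinner_commute[of "\<phi> i" x]
      by (simp add: cinner_scaleC_right)
    then show ?thesis by (metis Re_cinner complex_cnj(1) cnj.sel(1))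
  qed
  ultimately show ?thesis
    by (metis (mono_tags, lifting) has_sum_cong has_sum_unique inner_commute)
qed

lemma transfer_map_transfer_map:
  assumes \<phi>: "orthonormal_on I \<phi>" and \<psi>: "orthonormal_on I \<psi>" and \<theta>: "orthonormal_on I \<theta>"
  shows "transfer_map I \<psi> \<theta> (transfer_map I \<phi> \<psi> x) = transfer_map I \<phi> \<theta> x"
  unfolding transfer_map_apply[OF \<psi> \<theta>] transfer_map_apply[OF \<phi> \<theta>]
  by (rule infsum_cong) (simp add: cinner_transfer_map[OF \<phi> \<psi>])

text \<open>A maximal orthonormal set is a basis: the difference between \<open>x\<close> and its Fourier series is
  orthogonal to the set, and if it were not zero, its normalization could be added.\<close>

lemma orthonormal_basis_exists:
  obtains E :: "'h::chilbert_space set"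
  where "orthonormal_on E id" "\<And>x. transfer_map E id id x = x"
proof -
  have "\<exists>E\<in>{E :: 'h set. orthonormal_on E id}. \<forall>X\<in>{E. orthonormal_on E id}. E \<subseteq> X \<longrightarrow> X = E"
  proof (rule subset_Zorn')
    fix C assume C: "subset.chain {E :: 'h set. orthonormal_on E id} C"
    have "cinner x y = (if x = y then 1 else 0)" if "x \<in> X" "X \<in> C" "y \<in> Y" "Y \<in> C" for x y X Y
    proof -
      have "X \<subseteq> Y \<or> Y \<subseteq> X" using C that unfolding subset.chain_def by blast
      then have "x \<in> X \<and> y \<in> X \<or> x \<in> Y \<and> y \<in> Y" using that by blast
      moreover have "orthonormal_on X id" "orthonormal_on Y id"
        using C that unfolding subset.chain_def by blast+
      ultimately show ?thesis by (auto simp: orthonormal_on_def)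
    qed
    then show "\<Union> C \<in> {E :: 'h set. orthonormal_on E id}"
      by (auto simp: orthonormal_on_def)
  qed
  then obtain E :: "'h set" where E: "orthonormal_on E id"
    and max: "\<And>X. orthonormal_on X id \<Longrightarrow> E \<subseteq> X \<Longrightarrow> X = E"
    by blast
  have "transfer_map E id id x = x" for x
  proof (rule ccontr)
    assume neq: "transfer_map E id id x \<noteq> x"
    define y where "y = x - transfer_map E id id x"
    define z where "z = (1 / norm y) *\<^sub>R y"
    have "y \<noteq> 0" using neq by (simp add: y_def)
    have ey: "cinner e y = 0" if "e \<in> E" for e
      using cinner_transfer_map[OF E E that, of x] by (simp add: y_def cinner_diff_right)
    then have ez: "cinner e z = 0" "cinner z e = 0" if "e \<in> E" for e
      using that cinner_commute[of z e] by (simp_all add: z_def cinner_scaleR_right)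
    have zz: "cinner z z = 1"
      using \<open>y \<noteq> 0\<close> by (simp add: cinner_self z_def)
    then have "z \<notin> E" using ez by auto
    then have "orthonormal_on (insert z E) id"
      using E ez zz by (auto simp: orthonormal_on_def)
    then show False using max \<open>z \<notin> E\<close> by blast
  qed
  then show thesis using that E by blast
qed

section \<open>Operators on an orthogonal sum of two copies of the space\<close>

text \<open>An identification of \<open>H\<close> with \<open>H \<oplus> H\<close>: two isometries with orthogonal ranges that
  together span the space. The primed operators are the adjoints.\<close>

locale splitting =
  fixes V\<^sub>1 V\<^sub>1' V\<^sub>2 V\<^sub>2' :: "'h::chilbert_space \<Rightarrow>\<^sub>L 'h"
  assumes bounded_ops: "V\<^sub>1 \<in> bounded_ops" "V\<^sub>1' \<in> bounded_ops" "V\<^sub>2 \<in> bounded_ops" "V\<^sub>2' \<in> bounded_ops"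
    and adjoint\<^sub>1: "inner (V\<^sub>1 x) y = inner x (V\<^sub>1' y)"
    and adjoint\<^sub>2: "inner (V\<^sub>2 x) y = inner x (V\<^sub>2' y)"
    and isometry\<^sub>1 [simp]: "V\<^sub>1' (V\<^sub>1 x) = x"
    and isometry\<^sub>2 [simp]: "V\<^sub>2' (V\<^sub>2 x) = x"
    and orthogonal\<^sub>1\<^sub>2 [simp]: "V\<^sub>1' (V\<^sub>2 x) = 0"
    and orthogonal\<^sub>2\<^sub>1 [simp]: "V\<^sub>2' (V\<^sub>1 x) = 0"
    and complete: "V\<^sub>1 (V\<^sub>1' x) + V\<^sub>2 (V\<^sub>2' x) = x"

text \<open>An infinite orthonormal basis can be divided into two parts, each of which is in bijection with
  the whole.\<close>

lemma splitting_exists: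
  assumes "infinite_dimensional TYPE('h::chilbert_space)"
  shows "\<exists>V\<^sub>1 V\<^sub>1' V\<^sub>2 V\<^sub>2' :: 'h \<Rightarrow>\<^sub>L 'h. splitting V\<^sub>1 V\<^sub>1' V\<^sub>2 V\<^sub>2'"
proof -
  obtain E :: "'h set" where E: "orthonormal_on E id" and basis: "\<And>x. transfer_map E id id x = x"
    using orthonormal_basis_exists by blast
  have "infinite E"
  proof
    assume "finite E"
    have "x \<in> complex_vector.span E" for x
    proof -
      have "x = (\<Sum>e\<in>E. cinner e x *\<^sub>C e)"
        using basis[of x] \<open>finite E\<close> by (simp add: transfer_map_apply[OF E E])
      also have "\<dots> \<in> complex_vector.span E"
        by (intro complex_vector.span_sum complex_vector.span_scale complex_vector.span_base)
      finally show ?thesis .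
    qed
    then have "complex_vector.span E = UNIV" by blast
    then show False using assms \<open>finite E\<close> by (auto simp: infinite_dimensional_def)
  qed
  then obtain g where g: "bij_betw g (E <+> E) E"
    using card_of_Plus_infinite1[OF _ card_of_refl[THEN ordIso_imp_ordLeq], of E]
      card_of_ordIso[of "E <+> E" E] by blast
  define \<iota> where "\<iota> = (\<lambda>e. g (Inl e))"
  define \<kappa> where "\<kappa> = (\<lambda>e. g (Inr e))"
  have g_eq: "a = b" if "g a = g b" "a \<in> E <+> E" "b \<in> E <+> E" for a b
    using g that by (auto simp: bij_betw_def dest: inj_onD)
  have inj: "inj_on \<iota> E" "inj_on \<kappa> E"
    unfolding \<iota>_def \<kappa>_def by (auto intro!: inj_onI dest!: g_eq)
  have disj: "\<iota> ` E \<inter> \<kappa> ` E = {}"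
    unfolding \<iota>_def \<kappa>_def by (auto dest!: g_eq)
  have "g ` (E <+> E) = E" using g by (simp add: bij_betw_def)
  then have un: "\<iota> ` E \<union> \<kappa> ` E = E"
    unfolding \<iota>_def \<kappa>_def Plus_def by (simp add: image_Un image_image)
  have mem: "\<iota> e \<in> E" "\<kappa> e \<in> E" if "e \<in> E" for e
    using un that by blast+
  have on: "orthonormal_on E \<iota>" "orthonormal_on E \<kappa>"
    using E inj mem unfolding orthonormal_on_def by (simp_all add: inj_on_eq_iff)
  have perp: "cinner (\<iota> i) (\<kappa> j) = 0" "cinner (\<kappa> j) (\<iota> i) = 0" if "i \<in> E" "j \<in> E" for i j
    using cinner_orthonormal[OF E, of "\<iota> i" "\<kappa> j"] cinner_orthonormal[OF E, of "\<kappa> j" "\<iota> i"] un disj that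
    by fastforce+
  have sum: "((\<lambda>e. cinner e x *\<^sub>C e) has_sum transfer_map E \<eta> \<eta> x) (\<eta> ` E)"
    if "inj_on \<eta> E" "orthonormal_on E \<eta>" for \<eta> :: "'h \<Rightarrow> 'h" and x
    using has_sum_transfer_map[OF that(2) that(2)] by (simp add: has_sum_reindex[OF that(1)] o_def)
  have total: "transfer_map E \<iota> \<iota> x + transfer_map E \<kappa> \<kappa> x = x" for x
  proof (rule has_sum_unique)
    show "((\<lambda>e. cinner e x *\<^sub>C e) has_sum transfer_map E \<iota> \<iota> x + transfer_map E \<kappa> \<kappa> x) E"
      using has_sum_Un_disjoint[OF sum[OF inj(1) on(1)] sum[OF inj(2) on(2)] disj] un by simp
    show "((\<lambda>e. cinner e x *\<^sub>C e) has_sum x) E"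
      using has_sum_transfer_map[OF E E, of x] by (simp add: basis)
  qed
  have zero: "transfer_map E \<eta> id (transfer_map E id \<theta> x) = 0"
    if "orthonormal_on E \<eta>" "orthonormal_on E \<theta>"
      "\<And>i j. i \<in> E \<Longrightarrow> j \<in> E \<Longrightarrow> cinner (\<eta> i) (\<theta> j) = 0" for \<eta> \<theta> :: "'h \<Rightarrow> 'h" and x
    unfolding transfer_map_apply[OF that(1) E]
    using cinner_transfer_map_orthogonal[OF E that(2)] that(3) by (intro infsum_0) simp
  have "splitting (transfer_map E id \<iota>) (transfer_map E \<iota> id)
      (transfer_map E id \<kappa>) (transfer_map E \<kappa> id)"
    by standard
      (use E on perp in \<open>simp_all add: transfer_map_bounded_ops transfer_map_adjoint
        transfer_map_transfer_map basis zero total\<close>)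
  then show ?thesis by blast
qed

context splitting
begin

lemma norm_splitting: "(norm x)\<^sup>2 = (norm (V\<^sub>1' x))\<^sup>2 + (norm (V\<^sub>2' x))\<^sup>2"
proof -
  have "inner x x = inner (V\<^sub>1 (V\<^sub>1' x) + V\<^sub>2 (V\<^sub>2' x)) x"
    by (simp only: complete)
  then show ?thesis
    by (simp add: inner_add adjoint\<^sub>1 adjoint\<^sub>2 power2_norm_eq_inner)
qed

definition direct_sum :: "('h \<Rightarrow>\<^sub>L 'h) \<Rightarrow> ('h \<Rightarrow>\<^sub>L 'h) \<Rightarrow> 'h \<Rightarrow>\<^sub>L 'h" where
  "direct_sum X Y = (V\<^sub>1 o\<^sub>L X o\<^sub>L V\<^sub>1') + (V\<^sub>2 o\<^sub>L Y o\<^sub>L V\<^sub>2')"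

lemma direct_sum_apply: "direct_sum X Y x = V\<^sub>1 (X (V\<^sub>1' x)) + V\<^sub>2 (Y (V\<^sub>2' x))"
  by (simp add: direct_sum_def blinfun.add_left)

lemma inner_direct_sum:
  "inner x (direct_sum X Y y) = inner (V\<^sub>1' x) (X (V\<^sub>1' y)) + inner (V\<^sub>2' x) (Y (V\<^sub>2' y))"
  using adjoint\<^sub>1[of "X (V\<^sub>1' y)" x] adjoint\<^sub>2[of "Y (V\<^sub>2' y)" x]
  by (simp add: direct_sum_apply inner_add inner_commute)

lemma symmetric_op_direct_sum:
  assumes "symmetric_op X" "symmetric_op Y"
  shows "symmetric_op (direct_sum X Y)"
proof -
  have "inner (direct_sum X Y x) y = inner x (direct_sum X Y y)" for x y
  proof -
    have "inner (direct_sum X Y x) y = inner (V\<^sub>1' y) (X (V\<^sub>1' x)) + inner (V\<^sub>2' y) (Y (V\<^sub>2' x))"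
      by (simp only: inner_commute[of _ y] inner_direct_sum)
    also have "\<dots> = inner (V\<^sub>1' x) (X (V\<^sub>1' y)) + inner (V\<^sub>2' x) (Y (V\<^sub>2' y))"
      using assms by (simp only: inner_commute[of "V\<^sub>1' x"] inner_commute[of "V\<^sub>2' x"] symmetric_op_inner)
    finally show ?thesis
      by (simp only: inner_direct_sum)
  qed
  moreover have "direct_sum X Y \<in> bounded_ops"
    unfolding direct_sum_def
    using bounded_ops symmetric_op_bounded_ops[OF assms(1)] symmetric_op_bounded_ops[OF assms(2)]
    by (intro bounded_ops_add bounded_ops_compose)
  ultimately show ?thesis by (simp add: symmetric_op_def)
qed

lemma form_between_direct_sum:
  assumes "form_between m L X" "form_between m L Y"
  shows "form_between m L (direct_sum X Y)"
proof -
  have "m * (norm (V\<^sub>1' x))\<^sup>2 + m * (norm (V\<^sub>2' x))\<^sup>2 \<le> inner x (direct_sum X Y x)"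
    "inner x (direct_sum X Y x) \<le> L * (norm (V\<^sub>1' x))\<^sup>2 + L * (norm (V\<^sub>2' x))\<^sup>2" for x
    unfolding inner_direct_sum using assms by (auto simp: form_between_def intro: add_mono)
  moreover have "symmetric_op (direct_sum X Y)"
    using assms by (intro symmetric_op_direct_sum form_between_symmetric)
  ultimately show ?thesis
    unfolding form_between_def by (metis distrib_left norm_splitting)
qed

lemma poly_op_direct_sum: "poly_op p (direct_sum X Y) = direct_sum (poly_op p X) (poly_op p Y)"
proof (induction p)
  case 0
  show ?case
    by (rule blinfun_eqI) (simp add: poly_op_0 direct_sum_apply)
next
  case (pCons a p)
  show ?case
  proof (rule blinfun_eqI)
    fix x
    have "a *\<^sub>R x = a *\<^sub>R V\<^sub>1 (V\<^sub>1' x) + a *\<^sub>R V\<^sub>2 (V\<^sub>2' x)"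
      by (simp only: complete flip: scaleR_add_right)
    then show "poly_op (pCons a p) (direct_sum X Y) x =
        direct_sum (poly_op (pCons a p) X) (poly_op (pCons a p) Y) x"
      by (simp add: poly_op_pCons pCons.IH direct_sum_apply blinfun.add_left blinfun.add_right
          blinfun.scaleR_left blinfun.scaleR_right)
  qed
qed

lemma cfc_direct_sum:
  assumes X: "form_between m L X" and Y: "form_between m L Y" and f: "continuous_on {m..L} f"
  shows "cfc f (direct_sum X Y) = direct_sum (cfc f X) (cfc f Y)"
proof -
  obtain p where p: "uniform_limit {m..L} (\<lambda>n. poly (p n)) f sequentially"
    using uniform_real_poly_approx[OF f] .
  note comp = bounded_bilinear.tendsto[OF bounded_bilinear_blinfun_compose]
  have "(\<lambda>n. direct_sum (poly_op (p n) X) (poly_op (p n) Y)) \<longlonglongrightarrow> direct_sum (cfc f X) (cfc f Y)"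
    unfolding direct_sum_def
    by (intro tendsto_add comp tendsto_const poly_op_tendsto_cfc[OF X p] poly_op_tendsto_cfc[OF Y p])
  then have "(\<lambda>n. poly_op (p n) (direct_sum X Y)) \<longlonglongrightarrow> direct_sum (cfc f X) (cfc f Y)"
    by (simp only: poly_op_direct_sum)
  moreover have "(\<lambda>n. poly_op (p n) (direct_sum X Y)) \<longlonglongrightarrow> cfc f (direct_sum X Y)"
    by (rule poly_op_tendsto_cfc[OF form_between_direct_sum[OF X Y] p])
  ultimately show ?thesis by (rule LIMSEQ_unique[symmetric])
qed

text \<open>Rotation by an angle with cosine \<open>c\<close> and sine \<open>s\<close> in \<open>H \<oplus> H\<close>.\<close>

lemma splitting_rotate:
  assumes cs: "c\<^sup>2 + s\<^sup>2 = (1::real)"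
  shows "splitting (c *\<^sub>R V\<^sub>1 - s *\<^sub>R V\<^sub>2) (c *\<^sub>R V\<^sub>1' - s *\<^sub>R V\<^sub>2')
    (s *\<^sub>R V\<^sub>1 + c *\<^sub>R V\<^sub>2) (s *\<^sub>R V\<^sub>1' + c *\<^sub>R V\<^sub>2')"
proof
  note app = blinfun.add_left blinfun.diff_left blinfun.scaleR_left
    blinfun.add_right blinfun.diff_right blinfun.scaleR_right
  have one: "(c * c) *\<^sub>R x + (s * s) *\<^sub>R x = x" "(s * s) *\<^sub>R x + (c * c) *\<^sub>R x = x" for x :: 'h
    using cs by (simp_all add: power2_eq_square add.commute flip: scaleR_add_left)
  fix x y
  show "inner ((c *\<^sub>R V\<^sub>1 - s *\<^sub>R V\<^sub>2) x) y = inner x ((c *\<^sub>R V\<^sub>1' - s *\<^sub>R V\<^sub>2') y)"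
    "inner ((s *\<^sub>R V\<^sub>1 + c *\<^sub>R V\<^sub>2) x) y = inner x ((s *\<^sub>R V\<^sub>1' + c *\<^sub>R V\<^sub>2') y)"
    by (simp_all add: app inner_diff inner_add adjoint\<^sub>1 adjoint\<^sub>2)
  show "(c *\<^sub>R V\<^sub>1' - s *\<^sub>R V\<^sub>2') ((c *\<^sub>R V\<^sub>1 - s *\<^sub>R V\<^sub>2) x) = x"
    "(s *\<^sub>R V\<^sub>1' + c *\<^sub>R V\<^sub>2') ((s *\<^sub>R V\<^sub>1 + c *\<^sub>R V\<^sub>2) x) = x"
    "(c *\<^sub>R V\<^sub>1' - s *\<^sub>R V\<^sub>2') ((s *\<^sub>R V\<^sub>1 + c *\<^sub>R V\<^sub>2) x) = 0"
    "(s *\<^sub>R V\<^sub>1' + c *\<^sub>R V\<^sub>2') ((c *\<^sub>R V\<^sub>1 - s *\<^sub>R V\<^sub>2) x) = 0"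
    using one[of x] by (simp_all add: app mult.commute)
  have "(c *\<^sub>R V\<^sub>1 - s *\<^sub>R V\<^sub>2) ((c *\<^sub>R V\<^sub>1' - s *\<^sub>R V\<^sub>2') x) +
      (s *\<^sub>R V\<^sub>1 + c *\<^sub>R V\<^sub>2) ((s *\<^sub>R V\<^sub>1' + c *\<^sub>R V\<^sub>2') x) =
      ((c * c) *\<^sub>R V\<^sub>1 (V\<^sub>1' x) + (s * s) *\<^sub>R V\<^sub>1 (V\<^sub>1' x)) +
      ((c * c) *\<^sub>R V\<^sub>2 (V\<^sub>2' x) + (s * s) *\<^sub>R V\<^sub>2 (V\<^sub>2' x))"
    by (simp add: app scaleR_add_right scaleR_diff_right mult.commute)
  then show "(c *\<^sub>R V\<^sub>1 - s *\<^sub>R V\<^sub>2) ((c *\<^sub>R V\<^sub>1' - s *\<^sub>R V\<^sub>2') x) +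
      (s *\<^sub>R V\<^sub>1 + c *\<^sub>R V\<^sub>2) ((s *\<^sub>R V\<^sub>1' + c *\<^sub>R V\<^sub>2') x) = x"
    by (simp only: one complete)
qed (intro bounded_ops_add bounded_ops_diff bounded_ops_scaleR bounded_ops)+

end

section \<open>Monotone decreasing functions of weighted means\<close>

lemma form_between_convex_comb:
  assumes A: "form_between m L A" and B: "form_between m L B"
    and uv: "0 \<le> u" "0 \<le> v" "u + v = (1::real)"
  shows "form_between m L (u *\<^sub>R A + v *\<^sub>R B)"
  unfolding form_between_def
proof (intro conjI allI)
  show "symmetric_op (u *\<^sub>R A + v *\<^sub>R B)"
    using A B by (intro symmetric_op_add symmetric_op_scaleR form_between_symmetric)
  fix x
  have form: "inner x ((u *\<^sub>R A + v *\<^sub>R B) x) = u * inner x (A x) + v * inner x (B x)"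
    by (simp add: blinfun.add_left blinfun.scaleR_left inner_add)
  have "u * (m * (norm x)\<^sup>2) + v * (m * (norm x)\<^sup>2) \<le> inner x ((u *\<^sub>R A + v *\<^sub>R B) x)"
    unfolding form using A B uv by (intro add_mono mult_left_mono) (auto simp: form_between_def)
  moreover have "inner x ((u *\<^sub>R A + v *\<^sub>R B) x) \<le> u * (L * (norm x)\<^sup>2) + v * (L * (norm x)\<^sup>2)"
    unfolding form using A B uv by (intro add_mono mult_left_mono) (auto simp: form_between_def)
  ultimately show "m * (norm x)\<^sup>2 \<le> inner x ((u *\<^sub>R A + v *\<^sub>R B) x)"
    "inner x ((u *\<^sub>R A + v *\<^sub>R B) x) \<le> L * (norm x)\<^sup>2"
    using uv(3) by (simp_all flip: distrib_right)
qed

lemma form_between_add_id: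
  assumes "form_between m L A" "0 \<le> d"
  shows "form_between m (L + d) (A + d *\<^sub>R id_blinfun)"
proof -
  have "inner x ((A + d *\<^sub>R id_blinfun) x) = inner x (A x) + d * (norm x)\<^sup>2" for x
    by (simp add: blinfun.add_left blinfun.scaleR_left inner_add power2_norm_eq_inner)
  moreover have "0 \<le> d * (norm x)\<^sup>2" for x :: 'a
    using \<open>0 \<le> d\<close> by simp
  ultimately show ?thesis
    using assms(1)
    by (auto simp: form_between_def distrib_right
        intro: symmetric_op_add symmetric_op_scaleR symmetric_op_id add_increasing2)
qed

lemma form_between_scaleR_id: "form_between r r (r *\<^sub>R id_blinfun)"
  by (simp add: form_between_def symmetric_op_scaleR symmetric_op_id blinfun.scaleR_left
      power2_norm_eq_inner)

text \<open>The heart of the proof. Seen in coordinates rotated by \<open>(c, s)\<close>, the diagonal operator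
  \<open>A \<oplus> B\<close> is the block matrix with upper left corner \<open>M = c\<^sup>2 A + s\<^sup>2 B\<close> and off-diagonal entries
  \<open>c s (B - A)\<close>. An off-diagonal entry is dominated by an arbitrarily small multiple of the identity
  in one corner together with a large multiple in the other, so the matrix is at most
  \<open>(M + d) \<oplus> r\<close> for a suitable number \<open>r\<close>. As \<open>f\<close> reverses this inequality, \<open>f (M + d) \<oplus> f r\<close> is
  at most \<open>f A \<oplus> f B\<close> in the rotated coordinates. The term \<open>f r \<ge> 0\<close> may be dropped, and the
  inequality is evaluated at the vector with rotated coordinates \<open>(\<xi>, \<eta>)\<close>, whose first original
  coordinate is \<open>c \<xi> + s \<eta>\<close>. That \<open>\<xi>\<close> and \<open>\<eta>\<close> can be chosen independently is what makes this stronger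
  than operator convexity of \<open>f\<close>.\<close>

lemma (in splitting) cfc_rotated_sum_le:
  fixes A B :: "'h \<Rightarrow>\<^sub>L 'h"
  assumes f: "operator_monotone_decreasing TYPE('h) f" and nonneg: "\<And>t. 0 < t \<Longrightarrow> 0 \<le> f t"
    and A: "form_between m L A" and B: "form_between m L B" and "0 < m"
    and cs: "c\<^sup>2 + s\<^sup>2 = 1" and "0 < d"
  shows "inner (c *\<^sub>R \<xi> + s *\<^sub>R \<eta>)
      (cfc f (c\<^sup>2 *\<^sub>R A + s\<^sup>2 *\<^sub>R B + d *\<^sub>R id_blinfun) (c *\<^sub>R \<xi> + s *\<^sub>R \<eta>))
    \<le> inner \<xi> (cfc f A \<xi>) + inner \<eta> (cfc f B \<eta>)"
proof -
  define W\<^sub>1 W\<^sub>1' W\<^sub>2 W\<^sub>2'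
    where W_defs: "W\<^sub>1 = c *\<^sub>R V\<^sub>1 - s *\<^sub>R V\<^sub>2" "W\<^sub>1' = c *\<^sub>R V\<^sub>1' - s *\<^sub>R V\<^sub>2'"
      "W\<^sub>2 = s *\<^sub>R V\<^sub>1 + c *\<^sub>R V\<^sub>2" "W\<^sub>2' = s *\<^sub>R V\<^sub>1' + c *\<^sub>R V\<^sub>2'"
  interpret W: splitting W\<^sub>1 W\<^sub>1' W\<^sub>2 W\<^sub>2'
    unfolding W_defs by (rule splitting_rotate[OF cs])
  define M where "M = c\<^sup>2 *\<^sub>R A + s\<^sup>2 *\<^sub>R B"
  define K where "K = norm A + norm B"
  \<comment> \<open>\<open>K\<^sup>2 / d\<close> absorbs the off-diagonal part at the price \<open>d\<close> in the other corner, \<open>K\<close> dominates the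
      lower right corner \<open>s\<^sup>2 A + c\<^sup>2 B\<close>, and \<open>m\<close> keeps \<open>r\<close> above the common lower bound.\<close>
  define r where "r = K\<^sup>2 / d + K + m"
  define N where "N = max (L + d) r"
  define P where "P = W.direct_sum A B"
  define Q where "Q = direct_sum (M + d *\<^sub>R id_blinfun) (r *\<^sub>R id_blinfun)"
  have "0 \<le> K" by (simp add: K_def)
  then have "m \<le> r" using \<open>0 < d\<close> by (simp add: r_def)
  have M: "form_between m L M"
    unfolding M_def using A B cs by (intro form_between_convex_comb) auto
  have Md: "form_between m N (M + d *\<^sub>R id_blinfun)"
    by (rule form_between_mono[OF form_between_add_id[OF M]]) (use \<open>0 < d\<close> in \<open>auto simp: N_def\<close>)
  have R: "form_between m N (r *\<^sub>R id_blinfun :: 'h \<Rightarrow>\<^sub>L 'h)"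
    by (rule form_between_mono[OF form_between_scaleR_id]) (use \<open>m \<le> r\<close> in \<open>auto simp: N_def\<close>)
  have P: "form_between m L P"
    unfolding P_def by (rule W.form_between_direct_sum[OF A B])
  have Q: "form_between m N Q"
    unfolding Q_def by (rule form_between_direct_sum[OF Md R])
  have cont: "continuous_on {m..b} f" for b
    using f \<open>0 < m\<close> unfolding operator_monotone_decreasing_def
    by (auto elim!: continuous_on_subset)
  have "op_le P Q"
    unfolding op_le_def positive_op_iff
  proof (intro conjI allI)
    show "symmetric_op (Q - P)"
      using P Q by (intro symmetric_op_diff form_between_symmetric)
    fix z
    define x where "x = V\<^sub>1' z"
    define y where "y = V\<^sub>2' z"
    have W: "W\<^sub>1' z = c *\<^sub>R x - s *\<^sub>R y" "W\<^sub>2' z = s *\<^sub>R x + c *\<^sub>R y"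
      by (simp_all add: W_defs x_def y_def blinfun.add_left blinfun.diff_left blinfun.scaleR_left)
    have Pz: "inner z (P z) = inner x (M x)
        + c * s * (inner x (B y) + inner y (B x) - inner x (A y) - inner y (A x))
        + (s\<^sup>2 * inner y (A y) + c\<^sup>2 * inner y (B y))"
      unfolding P_def W.inner_direct_sum W M_def
      by (simp add: blinfun.add_left blinfun.scaleR_left blinfun.add_right blinfun.diff_right
          blinfun.scaleR_right inner_add inner_diff power2_eq_square algebra_simps)
    have Qz: "inner z (Q z) = inner x (M x) + d * (norm x)\<^sup>2 + r * (norm y)\<^sup>2"
      unfolding Q_def inner_direct_sum x_def[symmetric] y_def[symmetric]
      by (simp add: blinfun.add_left blinfun.scaleR_left inner_add power2_norm_eq_inner)
    have "\<bar>c * s\<bar> \<le> 1"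
    proof -
      have "2 * \<bar>c * s\<bar> \<le> c\<^sup>2 + s\<^sup>2"
        using sum_squares_bound[of "\<bar>c\<bar>" "\<bar>s\<bar>"] by (simp add: abs_mult)
      then show ?thesis using cs by linarith
    qed
    have "c * s * (inner x (B y) + inner y (B x) - inner x (A y) - inner y (A x))
        \<le> \<bar>c * s\<bar> * \<bar>inner x (B y) + inner y (B x) - inner x (A y) - inner y (A x)\<bar>"
      by (metis abs_ge_self abs_mult)
    also have "\<dots> \<le> 1 * (2 * K * norm x * norm y)"
    proof (rule mult_mono[OF \<open>\<bar>c * s\<bar> \<le> 1\<close>])
      show "\<bar>inner x (B y) + inner y (B x) - inner x (A y) - inner y (A x)\<bar> \<le> 2 * K * norm x * norm y"
        using abs_inner_blinfun_le[of x B y] abs_inner_blinfun_le[of y B x]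
          abs_inner_blinfun_le[of x A y] abs_inner_blinfun_le[of y A x]
        by (simp add: K_def algebra_simps abs_le_iff)
    qed simp_all
    also have "\<dots> \<le> d * (norm x)\<^sup>2 + K\<^sup>2 / d * (norm y)\<^sup>2"
    proof -
      have "0 \<le> (d * norm x - K * norm y)\<^sup>2 / d"
        using \<open>0 < d\<close> by simp
      also have "\<dots> = d * (norm x)\<^sup>2 + K\<^sup>2 / d * (norm y)\<^sup>2 - 2 * K * norm x * norm y"
        using \<open>0 < d\<close> by (simp add: power2_diff power_mult_distrib field_simps power2_eq_square)
      finally show ?thesis by simp
    qed
    finally have cross: "c * s * (inner x (B y) + inner y (B x) - inner x (A y) - inner y (A x))
        \<le> d * (norm x)\<^sup>2 + K\<^sup>2 / d * (norm y)\<^sup>2" .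
    have "s\<^sup>2 * inner y (A y) + c\<^sup>2 * inner y (B y) \<le> s\<^sup>2 * (K * (norm y)\<^sup>2) + c\<^sup>2 * (K * (norm y)\<^sup>2)"
      using inner_blinfun_self_le[of y A] inner_blinfun_self_le[of y B]
      by (intro add_mono mult_left_mono) (auto simp: K_def distrib_right intro: order_trans)
    also have "\<dots> = K * (norm y)\<^sup>2"
      using cs by (metis add.commute distrib_right mult_1)
    finally have "s\<^sup>2 * inner y (A y) + c\<^sup>2 * inner y (B y) \<le> K * (norm y)\<^sup>2" .
    moreover have "0 \<le> m * (norm y)\<^sup>2"
      using \<open>0 < m\<close> by simp
    ultimately have "inner z (P z) \<le> inner z (Q z)"
      unfolding Pz Qz r_def using cross by (simp add: distrib_right)
    then show "0 \<le> inner z ((Q - P) z)"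
      by (simp add: blinfun.diff_left inner_diff)
  qed
  moreover have "P \<in> positive_invertible_ops" "Q \<in> positive_invertible_ops"
    using P Q \<open>0 < m\<close> positive_invertible_ops_iff by blast+
  ultimately have "op_le (cfc f Q) (cfc f P)"
    using f by (simp add: operator_monotone_decreasing_def)
  then have "inner z (cfc f Q z) \<le> inner z (cfc f P z)" for z
    by (simp add: op_le_def positive_op_iff blinfun.diff_left inner_diff)
  note this[of "W\<^sub>1 \<xi> + W\<^sub>2 \<eta>"]
  also have "inner (W\<^sub>1 \<xi> + W\<^sub>2 \<eta>) (cfc f P (W\<^sub>1 \<xi> + W\<^sub>2 \<eta>)) = inner \<xi> (cfc f A \<xi>) + inner \<eta> (cfc f B \<eta>)"
    unfolding P_def W.cfc_direct_sum[OF A B cont] W.inner_direct_sum by (simp add: blinfun.add_right)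
  finally have le: "inner (W\<^sub>1 \<xi> + W\<^sub>2 \<eta>) (cfc f Q (W\<^sub>1 \<xi> + W\<^sub>2 \<eta>))
      \<le> inner \<xi> (cfc f A \<xi>) + inner \<eta> (cfc f B \<eta>)" .
  define z where "z = W\<^sub>1 \<xi> + W\<^sub>2 \<eta>"
  have Vz: "V\<^sub>1' z = c *\<^sub>R \<xi> + s *\<^sub>R \<eta>"
    by (simp add: z_def W_defs blinfun.add_left blinfun.diff_left blinfun.scaleR_left
        blinfun.add_right blinfun.diff_right blinfun.scaleR_right)
  have "inner z (cfc f Q z) = inner (V\<^sub>1' z) (cfc f (M + d *\<^sub>R id_blinfun) (V\<^sub>1' z))
      + inner (V\<^sub>2' z) (cfc f (r *\<^sub>R id_blinfun) (V\<^sub>2' z))"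
    unfolding Q_def cfc_direct_sum[OF Md R cont] by (rule inner_direct_sum)
  moreover have "0 \<le> inner y (cfc f (r *\<^sub>R id_blinfun) y)" for y :: 'h
    using nonneg \<open>0 < m\<close> by (intro cfc_nonneg[OF R cont]) auto
  ultimately have "inner (V\<^sub>1' z) (cfc f (M + d *\<^sub>R id_blinfun) (V\<^sub>1' z)) \<le> inner z (cfc f Q z)"
    by simp
  also note le[folded z_def]
  finally show ?thesis
    unfolding Vz M_def .
qed

text \<open>The preceding inequality with \<open>c = \<surd>u\<close>, \<open>s = \<surd>v\<close>, \<open>\<xi> = (p / c) x\<close> and \<open>\<eta> = (q / s) x\<close>, for
  which \<open>c \<xi> + s \<eta> = x\<close>, in the limit \<open>d \<rightarrow> 0\<close>.\<close>

lemma cfc_weighted_mean_le: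
  fixes A B :: "'h::chilbert_space \<Rightarrow>\<^sub>L 'h"
  assumes inf: "infinite_dimensional TYPE('h)"
    and f: "operator_monotone_decreasing TYPE('h) f" and nonneg: "\<And>t. 0 < t \<Longrightarrow> 0 \<le> f t"
    and A: "form_between m L A" and B: "form_between m L B" and "0 < m"
    and uv: "0 < u" "0 < v" "u + v = 1" and pq: "p + q = 1"
  shows "inner x (cfc f (u *\<^sub>R A + v *\<^sub>R B) x)
    \<le> p\<^sup>2 / u * inner x (cfc f A x) + q\<^sup>2 / v * inner x (cfc f B x)"
proof -
  obtain V\<^sub>1 V\<^sub>1' V\<^sub>2 V\<^sub>2' :: "'h \<Rightarrow>\<^sub>L 'h" where "splitting V\<^sub>1 V\<^sub>1' V\<^sub>2 V\<^sub>2'"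
    using splitting_exists[OF inf] by blast
  then interpret splitting V\<^sub>1 V\<^sub>1' V\<^sub>2 V\<^sub>2' .
  define M where "M = u *\<^sub>R A + v *\<^sub>R B"
  define d where "d n = inverse (real (Suc n))" for n
  have d: "0 < d n" "d n \<le> 1" for n
    by (simp_all add: d_def field_simps)
  have sq: "(sqrt u)\<^sup>2 = u" "(sqrt v)\<^sup>2 = v"
    using uv by simp_all
  have comb: "sqrt u *\<^sub>R (p / sqrt u) *\<^sub>R x + sqrt v *\<^sub>R (q / sqrt v) *\<^sub>R x = x"
    using uv pq by (simp flip: scaleR_add_left)
  have quad: "inner (a *\<^sub>R x) (X (a *\<^sub>R x)) = a\<^sup>2 * inner x (X x)" for a and X :: "'h \<Rightarrow>\<^sub>L 'h"
    by (simp add: blinfun.scaleR_right power2_eq_square)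
  have bound: "inner x (cfc f (M + d n *\<^sub>R id_blinfun) x)
      \<le> p\<^sup>2 / u * inner x (cfc f A x) + q\<^sup>2 / v * inner x (cfc f B x)" for n
    using cfc_rotated_sum_le[OF f nonneg A B \<open>0 < m\<close> _ d(1)[of n],
        of "sqrt u" "sqrt v" "(p / sqrt u) *\<^sub>R x" "(q / sqrt v) *\<^sub>R x"] uv
    unfolding comb sq quad by (simp add: M_def power_divide)
  have M: "form_between m L M"
    unfolding M_def using A B uv by (intro form_between_convex_comb) auto
  have Md: "form_between m (L + 1) (M + d n *\<^sub>R id_blinfun)" for n
    by (rule form_between_mono[OF form_between_add_id[OF M]]) (use d[of n] in auto)
  have cont: "continuous_on {m..L + 1} f"
    using f \<open>0 < m\<close> unfolding operator_monotone_decreasing_def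
    by (auto elim!: continuous_on_subset)
  have "d \<longlonglongrightarrow> 0"
    unfolding d_def by (rule LIMSEQ_inverse_real_of_nat)
  then have "(\<lambda>n. M + d n *\<^sub>R id_blinfun) \<longlonglongrightarrow> M + 0 *\<^sub>R id_blinfun"
    by (intro tendsto_intros)
  then have "(\<lambda>n. M + d n *\<^sub>R id_blinfun) \<longlonglongrightarrow> M"
    by simp
  then have "(\<lambda>n. cfc f (M + d n *\<^sub>R id_blinfun)) \<longlonglongrightarrow> cfc f M"
    by (intro tendsto_cfc[OF Md form_between_mono[OF M] cont]) simp_all
  then have "(\<lambda>n. inner x (cfc f (M + d n *\<^sub>R id_blinfun) x)) \<longlonglongrightarrow> inner x (cfc f M x)"
    by (rule tendsto_inner_blinfun)
  then show ?thesis
    unfolding M_def[symmetric] using bound by (intro LIMSEQ_le_const2) auto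
qed

section \<open>Logarithmic convexity\<close>

lemma positive_invertible_ops_common_bounds:
  assumes "A \<in> positive_invertible_ops" "B \<in> positive_invertible_ops"
  obtains m L where "0 < m" "form_between m L A" "form_between m L B"
proof -
  obtain m L where "0 < m" "form_between m L A"
    using assms(1) by (auto simp: positive_invertible_ops_iff)
  moreover obtain m' L' where "0 < m'" "form_between m' L' B"
    using assms(2) by (auto simp: positive_invertible_ops_iff)
  ultimately show thesis
    by (intro that[of "min m m'" "max L L'"]) (auto elim: form_between_mono)
qed

lemma positive_linear_functional_Re_comb:
  assumes "positive_linear_functional \<omega>" "X \<in> bounded_ops" "Y \<in> bounded_ops"
  shows "Re (\<omega> (a *\<^sub>R X + b *\<^sub>R Y)) = a * Re (\<omega> X) + b * Re (\<omega> Y)"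
proof -
  have "\<omega> (a *\<^sub>R X) = of_real a * \<omega> X" "\<omega> (b *\<^sub>R Y) = of_real b * \<omega> Y"
    using assms by (simp_all add: positive_linear_functional_def flip: scaleC_op_of_real)
  moreover have "\<omega> (a *\<^sub>R X + b *\<^sub>R Y) = \<omega> (a *\<^sub>R X) + \<omega> (b *\<^sub>R Y)"
    using assms(1) bounded_ops_scaleR[OF assms(2)] bounded_ops_scaleR[OF assms(3)]
    unfolding positive_linear_functional_def by blast
  ultimately show ?thesis by simp
qed

lemma positive_linear_functional_Re_nonneg:
  assumes "positive_linear_functional \<omega>" "symmetric_op X" "\<And>x. 0 \<le> inner x (X x)"
  shows "0 \<le> Re (\<omega> X)"
  using assms by (simp add: positive_linear_functional_def positive_op_iff complex_nonneg_Reals_iff)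

text \<open>If \<open>a\<close> or \<open>b\<close> vanishes, the bound with \<open>p = 1\<close> or \<open>q = 1\<close> gives \<open>c \<le> 0\<close>. Otherwise the best
  choice is \<open>p\<close> proportional to \<open>u / a\<close> and \<open>q\<close> proportional to \<open>v / b\<close>. It bounds \<open>c\<close> by the weighted
  harmonic mean \<open>1 / (u / a + v / b)\<close>, which is at most the geometric mean \<open>a\<^sup>u b\<^sup>v\<close>.\<close>

lemma eln_le_weighted_sum:
  fixes a b c u v :: real
  assumes ab: "0 \<le> a" "0 \<le> b" and uv: "0 < u" "0 < v" "u + v = 1"
    and bound: "\<And>p q. p + q = 1 \<Longrightarrow> c \<le> p\<^sup>2 / u * a + q\<^sup>2 / v * b"
  shows "eln c \<le> ereal u * eln a + ereal v * eln b"
proof (cases "c \<le> 0")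
  case False
  have "a \<noteq> 0" using bound[of 1 0] False by auto
  moreover have "b \<noteq> 0" using bound[of 0 1] False by auto
  ultimately have ab: "0 < a" "0 < b" using ab by auto
  define w where "w = u / a + v / b"
  have "0 < w" using ab uv by (simp add: w_def add_pos_pos)
  have "u / a / w + v / b / w = w / w"
    by (simp only: w_def add_divide_distrib)
  then have "c \<le> (u / a / w)\<^sup>2 / u * a + (v / b / w)\<^sup>2 / v * b"
    using \<open>0 < w\<close> by (intro bound) simp
  also have "\<dots> = (u / a + v / b) / w\<^sup>2"
    using ab uv \<open>0 < w\<close> by (simp add: power2_eq_square add_divide_distrib mult_ac)
  also have "\<dots> = 1 / w"
    using \<open>0 < w\<close> by (simp add: power2_eq_square flip: w_def)
  finally have "ln c \<le> ln (1 / w)"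
    using False \<open>0 < w\<close> by (intro ln_mono) auto
  also have "\<dots> = - ln w"
    using \<open>0 < w\<close> by (simp add: ln_div)
  also have "\<dots> \<le> u * ln a + v * ln b"
  proof -
    have "exp (u * (- ln a) + v * (- ln b)) \<le> u * exp (- ln a) + v * exp (- ln b)"
    proof -
      have vu: "1 - v = u" using uv by simp
      show ?thesis
        using convex_onD[OF exp_convex, of v "- ln a" "- ln b"] uv unfolding vu by simp
    qed
    also have "\<dots> = w"
      using ab by (simp add: w_def exp_minus field_simps)
    finally have "u * (- ln a) + v * (- ln b) \<le> ln w"
      using \<open>0 < w\<close> by (simp add: ln_ge_iff)
    then show ?thesis by simp
  qed
  finally show ?thesis
    using False ab by (simp add: eln_def)
qed (simp add: eln_def)

lemma convex_positive_invertible_ops: "convex (positive_invertible_ops :: ('h::chilbert_space \<Rightarrow>\<^sub>L 'h) set)"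
proof (rule convexI)
  fix A B :: "'h \<Rightarrow>\<^sub>L 'h" and u v :: real
  assume "A \<in> positive_invertible_ops" "B \<in> positive_invertible_ops" and uv: "0 \<le> u" "0 \<le> v" "u + v = 1"
  then obtain m L where "0 < m" "form_between m L A" "form_between m L B"
    using positive_invertible_ops_common_bounds by blast
  then show "u *\<^sub>R A + v *\<^sub>R B \<in> positive_invertible_ops"
    using form_between_convex_comb[OF _ _ uv] positive_invertible_ops_iff by blast
qed

theorem proposition1p1:
  fixes f :: "real \<Rightarrow> real"
    and \<omega> :: "('h::chilbert_space \<Rightarrow>\<^sub>L 'h) \<Rightarrow> complex"
  assumes "separable_space (euclidean :: 'h topology)"
    and "infinite_dimensional TYPE('h)"
    and "operator_monotone_decreasing TYPE('h) f"
    and "\<And>t. 0 < t \<Longrightarrow> 0 \<le> f t"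
    and "positive_linear_functional \<omega>"
  shows "ereal_convex_on positive_invertible_ops (\<lambda>A. eln (Re (\<omega> (cfc f A))))"
  unfolding ereal_convex_on_def
proof (intro conjI ballI allI impI)
  show "convex (positive_invertible_ops :: ('h \<Rightarrow>\<^sub>L 'h) set)"
    by (rule convex_positive_invertible_ops)
  show "eln (Re (\<omega> (cfc f A))) < \<infinity>" for A
    by (simp add: eln_def)
next
  fix A B :: "'h \<Rightarrow>\<^sub>L 'h" and u v :: real
  assume AB: "A \<in> positive_invertible_ops" "B \<in> positive_invertible_ops"
    and uv: "0 \<le> u" "0 \<le> v" "u + v = 1"
  show "eln (Re (\<omega> (cfc f (u *\<^sub>R A + v *\<^sub>R B))))
      \<le> ereal u * eln (Re (\<omega> (cfc f A))) + ereal v * eln (Re (\<omega> (cfc f B)))"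
  proof (cases "u = 0 \<or> v = 0")
    case True
    then consider "u = 0" "v = 1" | "u = 1" "v = 0" using uv by auto
    then show ?thesis by cases (simp_all flip: zero_ereal_def one_ereal_def)
  next
    case False
    then have uv': "0 < u" "0 < v" using uv by auto
    obtain m L where "0 < m" and A: "form_between m L A" and B: "form_between m L B"
      using AB by (rule positive_invertible_ops_common_bounds)
    have M: "form_between m L (u *\<^sub>R A + v *\<^sub>R B)"
      by (rule form_between_convex_comb[OF A B uv])
    have cont: "continuous_on {m..L} f"
      using assms(3) \<open>0 < m\<close> unfolding operator_monotone_decreasing_def
      by (auto elim!: continuous_on_subset)
    note sym = cfc_symmetric[OF A cont] cfc_symmetric[OF B cont] cfc_symmetric[OF M cont]
    note bdd = sym[THEN symmetric_op_bounded_ops]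
    have nonneg: "0 \<le> Re (\<omega> (cfc f X))" if "form_between m L X" for X
      using assms(4) \<open>0 < m\<close>
      by (intro positive_linear_functional_Re_nonneg[OF assms(5)] cfc_symmetric[OF that cont]
          cfc_nonneg[OF that cont]) auto
    show ?thesis
    proof (rule eln_le_weighted_sum[OF nonneg[OF A] nonneg[OF B] uv' uv(3)])
      fix p q :: real assume pq: "p + q = 1"
      define Y where "Y = (p\<^sup>2 / u) *\<^sub>R cfc f A + (q\<^sup>2 / v) *\<^sub>R cfc f B"
      have Y: "symmetric_op Y"
        unfolding Y_def using sym by (intro symmetric_op_add symmetric_op_scaleR)
      have "0 \<le> inner x ((Y - cfc f (u *\<^sub>R A + v *\<^sub>R B)) x)" for x
        using cfc_weighted_mean_le[OF assms(2-4) A B \<open>0 < m\<close> uv' uv(3) pq, of x]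
        by (simp add: Y_def blinfun.diff_left blinfun.add_left blinfun.scaleR_left inner_add inner_diff)
      then have "0 \<le> Re (\<omega> (Y - cfc f (u *\<^sub>R A + v *\<^sub>R B)))"
        by (intro positive_linear_functional_Re_nonneg[OF assms(5)] symmetric_op_diff Y sym)
      also have "\<dots> = Re (\<omega> Y) - Re (\<omega> (cfc f (u *\<^sub>R A + v *\<^sub>R B)))"
        using positive_linear_functional_Re_comb[OF assms(5) symmetric_op_bounded_ops[OF Y] bdd(3), of 1 "-1"]
        by simp
      also have "Re (\<omega> Y) = p\<^sup>2 / u * Re (\<omega> (cfc f A)) + q\<^sup>2 / v * Re (\<omega> (cfc f B))"
        unfolding Y_def by (rule positive_linear_functional_Re_comb[OF assms(5) bdd(1,2)])
      finally show "Re (\<omega> (cfc f (u *\<^sub>R A + v *\<^sub>R B)))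
          \<le> p\<^sup>2 / u * Re (\<omega> (cfc f A)) + q\<^sup>2 / v * Re (\<omega> (cfc f B))"
        by simp
    qed
  qed
qed

end
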